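(* Let $p\in(0,\infty)\setminus\mathbb{N}$, $\ell:=\lceil p-1\rceil$, and let $X$ be a real random variable with $\mathsf{E}\, X_+^p<\infty$. Then the following two conditions are equivalent: (I) $\mathsf{E}|X|^\ell<\infty$ and \[ \mathsf{E}\, X_+^p=\frac{\Gamma(p+1)}{\pi}\int_{0+}^\infty\operatorname{Re}\frac{\mathsf{E}\, e_\ell(itX)}{(it)^{p+1}}\,dt, \] where $\int_{0+}^\infty$ denotes $\lim_{v\downarrow0}\int_v^\infty$ (the integrals over $[v,\infty)$ taken in the Lebesgue sense); (II) $\mathsf{P}(X_->x)=o(x^{-p})$ as $x\to\infty$.
   Context: $x_+:=\max(0,x)$, $x_-:=\max(0,-x)$, $x_+^p:=(x_+)^p$. For complex $z$, $e_\ell(z):=e^z-\sum_{j=0}^\ell z^j/j!$. For $t>0$, $(it)^{p+1}:=t^{p+1}e^{i\pi(p+1)/2}$ (principal branch). *)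

theory Defs
  imports "HOL-Probability.Probability" "HOL-Library.Landau_Symbols"
begin

definition exp_rem :: "nat \<Rightarrow> complex \<Rightarrow> complex" where
  "exp_rem l z = exp z - (\<Sum>j\<le>l. z ^ j / of_nat (fact j))"

text \<open>(i t)^(p+1) := t^(p+1) * exp(i pi (p+1)/2) for t > 0 (principal branch)\<close>
definition it_pow :: "real \<Rightarrow> real \<Rightarrow> complex" where
  "it_pow p t = complex_of_real (t powr (p + 1)) * cis (pi * (p + 1) / 2)"

end

theory Submission
  imports Defs
begin

text \<open>
  Let \<open>T v x = \<integral>\<^bsub>t \<ge> v\<^esub> Re (e\<^sub>l (i t x) / (i t)\<^bsup>p+1\<^esup>) dt\<close> (\<open>trunc_int p l v x\<close>). By Fubini the truncated integral in (I)
  is \<open>E T v X\<close>, and scaling gives \<open>T v x = v\<^bsup>-p\<^esup> T 1 (v x)\<close>. A Laplace transform evaluates \<open>T 0\<close> for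
  \<open>p < 1\<close>; since \<open>d/dx\<close> lowers \<open>p\<close> and \<open>l\<close> by one, \<open>T 0 x = \<pi> / \<Gamma>(p+1) x\<^sub>+\<^bsup>p\<^esup>\<close> for all \<open>p\<close>. Dominated
  convergence disposes of \<open>X\<^sub>+\<close>, so that (I) says \<open>E T v (-X\<^sub>-) \<rightarrow> 0\<close>.

  The Tauberian direction rests on the fact that \<open>(-1)\<^bsup>l\<^esup> T 1 (-x) \<ge> 0\<close> for all \<open>x \<ge> 0\<close>, with a positive
  lower bound on some \<open>[c, 2c]\<close>: this controls \<open>P(x < X\<^sub>- \<le> 2x)\<close>, and dyadic summation controls the
  tail. The Abelian direction uses \<open>\<bar>T 1 (-x)\<bar> \<le> C min(x\<^bsup>l\<^esup>, x\<^bsup>l+1\<^esup>)\<close> and the layer cake formula.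
\<close>

section \<open>Integrals of powers, exponentials and sines\<close>

text \<open>The limit in (I) is a genuine one: with only E|X|^l finite, the integrand near t = 0 is
  controlled merely by t^(l-p-1), which is not integrable there. The two halves of X then behave
  differently. Since |T v x| <= C |x|^p uniformly in v, finiteness of E X_+^p yields a dominating
  function for X_+. For X_- there may be none, because a tail o(x^(-p)) is compatible with E X_-^p =
  infinity; T v (-x) tends to 0 for each x > 0, but its expectation need not, and (II) decides
  whether it does.

  Expectations of an oscillating integral could be small by cancellation alone, so the fixed sign of
  T 1 on the negative axis is the crux of the Tauberian half. Integration in x preserves a sign,
  hence only p < 1 needs analysis; there T 0 (-1) = 0 is the borderline case against which every
  other cutoff is compared.

  In the Abelian half the layer cake weight is chosen as s^p \<open>pow_dom\<close>, so that what
  remains is an average of x^p P(X_- > x), taken at x = s/v, against an integrable function that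
  does not depend on v.\<close>

lemma nn_integral_eq_has_bochner_integral:
  fixes f :: "'a \<Rightarrow> real"
  assumes "has_bochner_integral M f c" "\<And>x. 0 \<le> f x"
  shows "(\<integral>\<^sup>+ x. ennreal (f x) \<partial>M) = ennreal c"
  using assms by (subst nn_integral_eq_integral) (auto simp: has_bochner_integral_iff)

lemma has_bochner_integral_Gamma_scaled:
  fixes q c :: real
  assumes "q > 0" "c > 0"
  shows "has_bochner_integral lborel
    (\<lambda>t. indicator {0<..} t * (t powr (q - 1) * exp (- (c * t)))) (Gamma q * c powr (- q))"
proof -
  have "has_bochner_integral lborel (\<lambda>t. indicator {0<..} t * (t powr (q - 1) * exp (- t))) (Gamma q)"
  proof (rule has_bochner_integral_nn_integral)
    show "(\<integral>\<^sup>+ x. ennreal (indicator {0<..} x * (x powr (q - 1) * exp (- x))) \<partial>lborel) = ennreal (Gamma q)"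
      unfolding Gamma_conv_nn_integral_real[OF assms(1)]
      by (intro nn_integral_cong) (auto simp: indicator_def exp_minus field_simps)
  qed (use assms in \<open>auto simp: Gamma_real_pos less_imp_le\<close>)
  from lborel_has_bochner_integral_real_affine_iff[of c _ _ 0, THEN iffD1, OF _ this]
  have "has_bochner_integral lborel (\<lambda>t. indicator {0<..} (c * t) * ((c * t) powr (q - 1) * exp (- (c * t)))) (Gamma q / c)"
    using assms by (simp add: divide_inverse mult.commute)
  from has_bochner_integral_mult_right[OF this, of "c powr (1 - q)"]
  have "has_bochner_integral lborel
    (\<lambda>t. c powr (1 - q) * (indicator {0<..} (c * t) * ((c * t) powr (q - 1) * exp (- (c * t))))) (c powr (1 - q) * (Gamma q / c))" .
  moreover have "c powr (1 - q) * (Gamma q / c) = Gamma q * c powr (- q)"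
    using assms by (simp add: powr_diff powr_minus field_simps)
  moreover have "c powr (1 - q) * (indicator {0<..} (c * t) * ((c * t) powr (q - 1) * exp (- (c * t)))) = 
     indicator {0<..} t * (t powr (q - 1) * exp (- (c * t)))" for t :: real
    using assms by (auto simp: indicator_def zero_less_mult_iff powr_mult powr_add[symmetric] simp flip: mult.assoc)
  ultimately show ?thesis by simp
qed

text \<open>Writing 1/(1+t) as the integral of exp(-u(1+t)) over u > 0 and exchanging the two
  integrals of a nonnegative function gives Gamma(q) Gamma(1-q); the reflection formula does the
  rest.\<close>

lemma has_bochner_integral_powr_inverse_one_plus:
  fixes q :: real
  assumes "0 < q" "q < 1"
  shows "has_bochner_integral lborel (\<lambda>t. indicator {0<..} t * (t powr (q - 1) / (1 + t))) (pi / sin (pi * q))"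
proof (rule has_bochner_integral_nn_integral)
  let ?f = "\<lambda>t u :: real. indicator {0<..} t * indicator {0<..} u * (t powr (q - 1) * exp (- (u * (1 + t))))"
  have "(\<integral>\<^sup>+ t. ennreal (indicator {0<..} t * (t powr (q - 1) / (1 + t))) \<partial>lborel)
      = (\<integral>\<^sup>+ t. (\<integral>\<^sup>+ u. ennreal (?f t u) \<partial>lborel) \<partial>lborel)"
  proof (intro nn_integral_cong)
    fix t :: real
    show "ennreal (indicator {0<..} t * (t powr (q - 1) / (1 + t))) = (\<integral>\<^sup>+ u. ennreal (?f t u) \<partial>lborel)"
    proof (cases "t > 0")
      case True
      have "has_bochner_integral lborel (\<lambda>u. t powr (q - 1) * (indicator {0<..} u * (u powr (1 - 1) * exp (- ((1 + t) * u)))))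
            (t powr (q - 1) * (Gamma 1 * (1 + t) powr (- 1)))"
        using True by (intro has_bochner_integral_mult_right has_bochner_integral_Gamma_scaled) auto
      moreover have "t powr (q - 1) * (indicator {0<..} u * (u powr (1 - 1) * exp (- ((1 + t) * u)))) = ?f t u" for u
        using True by (auto simp: indicator_def algebra_simps)
      moreover have "t powr (q - 1) * (Gamma 1 * (1 + t) powr (- 1)) = t powr (q - 1) / (1 + t)"
        using True by (simp add: powr_minus field_simps)
      ultimately have "has_bochner_integral lborel (?f t) (t powr (q - 1) / (1 + t))"
        by (simp only:)
      from nn_integral_eq_has_bochner_integral [OF this] show ?thesis using True by simp
    qed (simp)
  qed
  also have "\<dots> = (\<integral>\<^sup>+ u. (\<integral>\<^sup>+ t. ennreal (?f t u) \<partial>lborel) \<partial>lborel)"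
    by (rule lborel_pair.Fubini') simp
  also have "\<dots> = (\<integral>\<^sup>+ u. ennreal (Gamma q * (indicator {0<..} u * (u powr ((1 - q) - 1) * exp (- (1 * u))))) \<partial>lborel)"
  proof (intro nn_integral_cong)
    fix u :: real
    show "(\<integral>\<^sup>+ t. ennreal (?f t u) \<partial>lborel) = ennreal (Gamma q * (indicator {0<..} u * (u powr ((1 - q) - 1) * exp (- (1 * u)))))"
    proof (cases "u > 0")
      case True
      have "has_bochner_integral lborel (\<lambda>t. exp (- u) * (indicator {0<..} t * (t powr (q - 1) * exp (- (u * t)))))
            (exp (- u) * (Gamma q * u powr (- q)))"
        using True assms by (intro has_bochner_integral_mult_right has_bochner_integral_Gamma_scaled) auto
      moreover have "exp (- u) * (indicator {0<..} t * (t powr (q - 1) * exp (- (u * t)))) = ?f t u" for t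
        using True by (auto simp: indicator_def algebra_simps exp_add[symmetric])
      ultimately have "has_bochner_integral lborel (\<lambda>t. ?f t u) (exp (- u) * (Gamma q * u powr (- q)))"
        by simp
      from nn_integral_eq_has_bochner_integral [OF this] show ?thesis using True by (simp add: mult_ac)
    qed simp
  qed
  also have "\<dots> = ennreal (Gamma q * (Gamma (1 - q) * 1 powr (- (1 - q))))"
    using assms 
    by (intro nn_integral_eq_has_bochner_integral has_bochner_integral_mult_right has_bochner_integral_Gamma_scaled)
       (auto simp: indicator_def Gamma_real_pos less_imp_le)
  also have "Gamma q * (Gamma (1 - q) * 1 powr (- (1 - q))) = pi / sin (pi * q)"
  proof -
    have "complex_of_real (Gamma q * Gamma (1 - q)) = complex_of_real (pi / sin (pi * q))"
      using Gamma_reflection_complex[of "of_real q"] 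
      by (simp add: Gamma_complex_of_real[symmetric] sin_of_real[symmetric])
    thus ?thesis by (simp only: of_real_eq_iff) simp
  qed
  finally show "(\<integral>\<^sup>+ t. ennreal (indicator {0<..} t * (t powr (q - 1) / (1 + t))) \<partial>lborel) = ennreal (pi / sin (pi * q))" .
  show "0 \<le> pi / sin (pi * q)" using assms by (intro divide_nonneg_nonneg sin_ge_zero) auto
qed (auto simp: indicator_def)

text \<open>Substituting \<open>sqrt t\<close> for t leads back to the preceding integral with q/2
  in place of q, which is why q may range up to 2.\<close>

lemma has_bochner_integral_powr_inverse_one_plus_square:
  fixes q :: real
  assumes "0 < q" "q < 2"
  shows "has_bochner_integral lborel (\<lambda>t. indicator {0<..} t * (t powr (q - 1) / (1 + t\<^sup>2))) (pi / (2 * sin (pi * q / 2)))"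
proof -
  let ?f = "\<lambda>t::real. t powr (q - 1) / (1 + t\<^sup>2)"
  let ?g = "\<lambda>t::real. inverse (2 * sqrt t)"
  have I: "has_bochner_integral lborel (\<lambda>t. indicator {0<..} t * (t powr (q / 2 - 1) / (1 + t))) (pi / sin (pi * (q / 2)))"
    using assms by (intro has_bochner_integral_powr_inverse_one_plus) auto
  have eq: "indicator {0<..} t * (?f (sqrt t) * ?g t) = 1/2 * (indicator {0<..} t * (t powr (q / 2 - 1) / (1 + t)))" for t :: real
  proof (cases "t > 0")
    case True
    have "sqrt t powr (q - 1) / sqrt t = t powr (q / 2 - 1)"
      using True by (simp add: powr_half_sqrt[symmetric] powr_powr powr_diff[symmetric]) (simp add: diff_divide_distrib)
    thus ?thesis using True by (simp add: field_simps)
  qed simp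
  have I2: "has_bochner_integral lborel (\<lambda>t. indicator {0<..} t * (?f (sqrt t) * ?g t)) (1/2 * (pi / sin (pi * (q / 2))))"
    unfolding eq by (rule has_bochner_integral_mult_right[OF I])
  have E: "einterval 0 \<infinity> = {0<..}" by (auto simp: einterval_def)
  note S = interval_integral_substitution_nonneg[of 0 "\<infinity>" sqrt ?g ?f 0 "\<infinity>"]
  have c1: "set_integrable lborel (einterval 0 \<infinity>) (\<lambda>x. ?f (sqrt x) * ?g x)"
    using I2 unfolding E set_integrable_def real_scaleR_def by (rule integrable.intros)
  have c2: "((ereal \<circ> sqrt \<circ> real_of_ereal) \<longlongrightarrow> 0) (at_right 0)"
    by (auto simp: zero_ereal_def ereal_tendsto_simps intro!: tendsto_eq_intros)
  have c3: "((ereal \<circ> sqrt \<circ> real_of_ereal) \<longlongrightarrow> \<infinity>) (at_left \<infinity>)"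
    by (simp add: ereal_tendsto_simps sqrt_at_top)
  have c0: "1 + t\<^sup>2 \<noteq> 0" for t :: real
    using zero_le_power2[of t] by linarith
  have p1: "0 < ereal x \<Longrightarrow> ereal x < \<infinity> \<Longrightarrow> DERIV sqrt x :> ?g x" for x
    by (auto intro!: derivative_eq_intros simp: zero_ereal_def divide_simps)
  have p2: "0 < ereal x \<Longrightarrow> ereal x < \<infinity> \<Longrightarrow> isCont ?f (sqrt x)" for x
    using c0 by (auto intro!: continuous_intros)
  have p3: "0 < ereal x \<Longrightarrow> ereal x < \<infinity> \<Longrightarrow> isCont ?g x" for x
    by (auto intro!: continuous_intros simp: zero_ereal_def)
  have p4: "0 < ereal x \<Longrightarrow> ereal x < \<infinity> \<Longrightarrow> 0 \<le> ?f (sqrt x)" for x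
    by auto
  have p5: "0 \<le> ereal x \<Longrightarrow> ereal x \<le> \<infinity> \<Longrightarrow> 0 \<le> ?g x" for x
    by auto
  have S1: "set_integrable lborel (einterval 0 \<infinity>) ?f" and S2: "(LBINT x=0..\<infinity>. ?f x) = (LBINT x=0..\<infinity>. (?f (sqrt x) * ?g x))"
    using S[OF _ p1 p2 p3 p4 p5 c2 c3 c1] by simp_all
  have "integrable lborel (\<lambda>t. indicator {0<..} t * ?f t)"
    using S1 unfolding E set_integrable_def real_scaleR_def .
  moreover have "integral\<^sup>L lborel (\<lambda>t. indicator {0<..} t * ?f t) = pi / (2 * sin (pi * q / 2))"
    using S2 has_bochner_integral_integral_eq[OF I2] 
    by (simp add: interval_lebesgue_integral_0_infty set_lebesgue_integral_def)
  ultimately show ?thesis by (simp add: has_bochner_integral_iff)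
qed

text \<open>An explicit antiderivative gives the value. This becomes the inner integral over s in
  the Laplace representation of the case p < 1.\<close>

lemma has_bochner_integral_exp_sin_shift:
  fixes a \<phi> :: real
  assumes "a > 0"
  shows "has_bochner_integral lborel (\<lambda>s. indicator {0<..} s * (exp (- (a * s)) * (sin (s + \<phi>) - sin \<phi>)))
     ((a * cos \<phi> - sin \<phi>) / (a * (a\<^sup>2 + 1)))"
proof -
  let ?f = "\<lambda>s. exp (- (a * s)) * (sin (s + \<phi>) - sin \<phi>)"
  let ?F = "\<lambda>s. exp (- (a * s)) * (sin \<phi> / a - (a * sin (s + \<phi>) + cos (s + \<phi>)) / (a\<^sup>2 + 1))"
  have E: "einterval 0 \<infinity> = {0<..}" by (auto simp: einterval_def)
  have a1: "a\<^sup>2 + 1 \<noteq> 0" using zero_le_power2[of a] by linarith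
  have i: "set_integrable lborel {0<..} ?f"
  proof -
    have "integrable lborel (\<lambda>s. 2 * (indicator {0<..} s * exp (- (s * a))))"
      using integrable_I0i_exp_mscale[OF assms] by (auto simp: set_integrable_def)
    then show ?thesis unfolding set_integrable_def
    proof (rule Bochner_Integration.integrable_bound, goal_cases)
      case 2
      have *: "\<bar>sin (x + \<phi>) - sin \<phi>\<bar> \<le> 2" for x
        using abs_sin_le_one[of "x + \<phi>"] abs_sin_le_one[of \<phi>] by linarith
      show ?case 
        by (auto simp: indicator_def abs_mult mult_ac intro!: mult_right_mono *)
    qed auto
  qed
  have lim: "((\<lambda>s. exp (- (a * s))) \<longlongrightarrow> 0) at_top"
    using assms
    by (auto intro!: exp_at_bot[THEN filterlim_compose] filterlim_tendsto_pos_mult_at_top filterlim_ident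
             simp: filterlim_uminus_at_bot)
  \<comment> \<open>The bracket in \<open>?F\<close> stays bounded, so the exponential factor forces
    \<open>?F\<close> to 0 at infinity and the integral is \<open>- ?F 0\<close>.\<close>
  have bdd: "norm (sin \<phi> / a - (a * sin (s + \<phi>) + cos (s + \<phi>)) / (a\<^sup>2 + 1)) \<le> 1 / a + (a + 1)" for s
  proof -
    have "\<bar>sin \<phi> / a\<bar> \<le> 1 / a" using assms by (simp add: divide_right_mono)
    moreover have "\<bar>(a * sin (s + \<phi>) + cos (s + \<phi>)) / (a\<^sup>2 + 1)\<bar> \<le> a + 1"
    proof -
      have "\<bar>a * sin (s + \<phi>) + cos (s + \<phi>)\<bar> / \<bar>a\<^sup>2 + 1\<bar> \<le> (a + 1) / 1"
    proof (rule frac_le)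
      have "\<bar>a * sin (s + \<phi>)\<bar> \<le> a * 1"
        using assms by (auto simp: abs_mult)
      thus "\<bar>a * sin (s + \<phi>) + cos (s + \<phi>)\<bar> \<le> a + 1"
        using abs_cos_le_one[of "s + \<phi>"] by linarith
    qed (use assms in auto)
      thus ?thesis by (simp add: abs_divide)
    qed
    ultimately show ?thesis unfolding real_norm_def by linarith
  qed
  have "(LBINT s=0..\<infinity>. ?f s) = 0 - ?F 0"
  proof (rule interval_integral_FTC_integrable)
    show "((?F \<circ> real_of_ereal) \<longlongrightarrow> 0) (at_left \<infinity>)"
      unfolding ereal_tendsto_simps
    proof (rule Lim_null_comparison)
      show "\<forall>\<^sub>F s in at_top. norm (?F s) \<le> exp (- (a * s)) * (1 / a + (a + 1))"
        unfolding norm_mult using bdd by (intro always_eventually allI mult_mono) auto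
      show "((\<lambda>s. exp (- (a * s)) * (1 / a + (a + 1))) \<longlongrightarrow> 0) at_top"
        using tendsto_mult_right[OF lim, of "1 / a + (a + 1)"] by (simp add: mult.commute)
    qed
    show "((?F \<circ> real_of_ereal) \<longlongrightarrow> ?F 0) (at_right 0)"
      unfolding ereal_tendsto_simps zero_ereal_def using assms a1
      by (intro tendsto_eq_intros) auto
    show "(?F has_vector_derivative ?f x) (at x)" for x
    proof -
      have "(?F has_real_derivative exp (- (a * x)) * (- a) * (sin \<phi> / a - (a * sin (x + \<phi>) + cos (x + \<phi>)) / (a\<^sup>2 + 1))
         + exp (- (a * x)) * (- ((a * cos (x + \<phi>) - sin (x + \<phi>)) / (a\<^sup>2 + 1)))) (at x)"
      proof -
        define k where "k = inverse (a\<^sup>2 + 1)"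
        define m where "m = sin \<phi> / a"
        show ?thesis
          unfolding divide_inverse[of _ "a\<^sup>2 + 1"] k_def[symmetric] m_def[symmetric]
          by (auto intro!: derivative_eq_intros simp: algebra_simps)
      qed
      also have "exp (- (a * x)) * (- a) * (sin \<phi> / a - (a * sin (x + \<phi>) + cos (x + \<phi>)) / (a\<^sup>2 + 1))
         + exp (- (a * x)) * (- ((a * cos (x + \<phi>) - sin (x + \<phi>)) / (a\<^sup>2 + 1)))
        = exp (- (a * x)) * ((a * (a * sin (x + \<phi>) + cos (x + \<phi>)) - (a * cos (x + \<phi>) - sin (x + \<phi>))) / (a\<^sup>2 + 1) - sin \<phi>)"
        using assms by (simp add: algebra_simps diff_divide_distrib add_divide_distrib)
      also have "a * (a * sin (x + \<phi>) + cos (x + \<phi>)) - (a * cos (x + \<phi>) - sin (x + \<phi>)) = (a\<^sup>2 + 1) * sin (x + \<phi>)"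
        by (simp add: algebra_simps power2_eq_square)
      finally show ?thesis using a1
        by (simp add: has_real_derivative_iff_has_vector_derivative)
    qed
  qed (use i E in auto)
  also have "0 - ?F 0 = (a * cos \<phi> - sin \<phi>) / (a * (a\<^sup>2 + 1))"
    using assms a1 by (simp add: divide_simps) (simp add: algebra_simps power2_eq_square)
  finally show ?thesis using i
    by (simp add: has_bochner_integral_iff set_integrable_def interval_lebesgue_integral_0_infty set_lebesgue_integral_def)
qed

section \<open>The truncated integral\<close>

text \<open>Division by \<open>it_pow p 0 = 0\<close> makes \<open>kern p l 0 x = 0\<close>, so no care is needed at \<open>t = 0\<close>.\<close>

definition kern :: "real \<Rightarrow> nat \<Rightarrow> real \<Rightarrow> real \<Rightarrow> real" where
  "kern p l t x = Re (exp_rem l (\<i> * complex_of_real (t * x)) / it_pow p t)"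

definition trunc_int :: "real \<Rightarrow> nat \<Rightarrow> real \<Rightarrow> real \<Rightarrow> real" where
  "trunc_int p l v x = (\<integral>t. indicator {v..} t * kern p l t x \<partial>lborel)"

text \<open>\<open>min (t\<^bsup>l\<^esup>, t\<^bsup>l+1\<^esup>) t\<^bsup>-p-1\<^esup>\<close> on the positive half-line.\<close>

definition pow_dom :: "real \<Rightarrow> nat \<Rightarrow> real \<Rightarrow> real" where
  "pow_dom p l t = (if t \<le> 0 then 0 else if t \<le> 1 then t powr (real l - p) else t powr (real l - p - 1))"

lemma norm_it_pow: "norm (it_pow p t) = t powr (p + 1)"
  by (simp add: it_pow_def norm_mult)

text \<open>This Taylor bound of order l serves large arguments, the next one of order l + 1 small
  arguments. The factorials are dropped, since the size of the constants is immaterial.\<close>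

lemma norm_exp_rem_le1: "norm (exp_rem l (\<i> * complex_of_real x)) \<le> 2 * \<bar>x\<bar> ^ l"
proof -
  have "norm (exp_rem l (\<i> * complex_of_real x)) \<le> 2 * \<bar>x\<bar> ^ l / fact l"
    using iexp_approx2[of x l] by (simp add: exp_rem_def)
  also have "\<dots> \<le> 2 * \<bar>x\<bar> ^ l / 1"
    by (intro divide_left_mono) (auto simp: fact_ge_1)
  finally show ?thesis by simp
qed

lemma norm_exp_rem_le2: "norm (exp_rem l (\<i> * complex_of_real x)) \<le> \<bar>x\<bar> ^ Suc l"
proof -
  have "norm (exp_rem l (\<i> * complex_of_real x)) \<le> \<bar>x\<bar> ^ Suc l / fact (Suc l)"
    using iexp_approx1[of x l] by (simp add: exp_rem_def)
  also have "\<dots> \<le> \<bar>x\<bar> ^ Suc l / 1"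
    by (intro divide_left_mono) (auto simp: fact_ge_1 simp del: fact_Suc)
  finally show ?thesis by simp
qed

lemma abs_kern_le: "\<bar>kern p l t x\<bar> \<le> norm (exp_rem l (\<i> * complex_of_real (t * x))) * t powr (- p - 1)"
proof -
  have "\<bar>kern p l t x\<bar> \<le> norm (exp_rem l (\<i> * complex_of_real (t * x)) / it_pow p t)"
    unfolding kern_def by (rule abs_Re_le_cmod)
  also have "\<dots> = norm (exp_rem l (\<i> * complex_of_real (t * x))) * t powr (- (p + 1))"
    by (simp only: norm_divide norm_it_pow powr_minus) (simp only: divide_inverse)
  also have "- (p + 1) = - p - 1" by simp
  finally show ?thesis .
qed

lemma kern_0_left [simp]: "kern p l 0 x = 0"
  by (simp add: kern_def it_pow_def)

lemma kern_0_right [simp]: "kern p l t 0 = 0"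
proof -
  have "norm (exp_rem l (\<i> * complex_of_real 0)) \<le> 0"
    using norm_exp_rem_le2[of l 0] by simp
  thus ?thesis by (simp add: kern_def)
qed

lemma powr_mult_power:
  fixes t :: real
  assumes "t > 0"
  shows "t ^ n * t powr a = t powr (real n + a)"
  using assms by (simp add: powr_add powr_realpow)

lemma abs_kern_le_large:
  assumes "t > 0"
  shows "\<bar>kern p l t x\<bar> \<le> 2 * \<bar>x\<bar> ^ l * t powr (real l - p - 1)"
proof -
  have "\<bar>kern p l t x\<bar> \<le> 2 * \<bar>t * x\<bar> ^ l * t powr (- p - 1)"
    by (rule order.trans[OF abs_kern_le]) (intro mult_right_mono norm_exp_rem_le1, simp)
  also have "\<dots> = 2 * \<bar>x\<bar> ^ l * (t ^ l * t powr (- p - 1))"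
    using assms by (simp add: abs_mult power_mult_distrib)
  also have "t ^ l * t powr (- p - 1) = t powr (real l - p - 1)"
    using assms by (subst powr_mult_power) (auto simp: algebra_simps)
  finally show ?thesis .
qed

lemma abs_kern_le_small:
  assumes "t > 0"
  shows "\<bar>kern p l t x\<bar> \<le> \<bar>x\<bar> ^ Suc l * t powr (real l - p)"
proof -
  have "\<bar>kern p l t x\<bar> \<le> \<bar>t * x\<bar> ^ Suc l * t powr (- p - 1)"
    by (rule order.trans[OF abs_kern_le]) (intro mult_right_mono norm_exp_rem_le2, simp)
  also have "\<dots> = \<bar>x\<bar> ^ Suc l * (t ^ Suc l * t powr (- p - 1))"
    using assms by (simp add: abs_mult power_mult_distrib)
  also have "t ^ Suc l * t powr (- p - 1) = t powr (real l - p)"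
    using assms by (subst powr_mult_power) (auto simp: algebra_simps)
  finally show ?thesis .
qed

lemma pow_dom_nonneg: "0 \<le> pow_dom p l t"
  by (simp add: pow_dom_def)

text \<open>Adding both powers of |x| separates the variables: one integrable function of t then
  serves every dominated convergence and Fubini argument at fixed or bounded x.\<close>

lemma abs_kern_le_pow_dom:
  assumes "t \<ge> 0"
  shows "\<bar>kern p l t x\<bar> \<le> 2 * (\<bar>x\<bar> ^ l + \<bar>x\<bar> ^ Suc l) * pow_dom p l t"
proof (cases "t = 0")
  case False
  with assms have t: "t > 0" by simp
  show ?thesis
  proof (cases "t \<le> 1")
    case True
    have "\<bar>x\<bar> ^ Suc l * t powr (real l - p) \<le> 2 * (\<bar>x\<bar> ^ l + \<bar>x\<bar> ^ Suc l) * t powr (real l - p)"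
      by (intro mult_right_mono) auto
    from order.trans[OF abs_kern_le_small[OF t, of p l x] this] show ?thesis using t True by (simp add: pow_dom_def)
  next
    case False
    have "2 * \<bar>x\<bar> ^ l * t powr (real l - p - 1) \<le> 2 * (\<bar>x\<bar> ^ l + \<bar>x\<bar> ^ Suc l) * t powr (real l - p - 1)"
      by (intro mult_right_mono) auto
    from order.trans[OF abs_kern_le_large[OF t, of p l x] this] show ?thesis using t False by (simp add: pow_dom_def)
  qed
qed (simp add: pow_dom_def)

lemma pow_dom_measurable [measurable]: "pow_dom p l \<in> borel_measurable borel"
  unfolding pow_dom_def by measurable

text \<open>The strict inequalities l < p < l + 1 are exactly what makes the exponent l - p exceed
  -1 near 0 and l - p - 1 fall below -1 at infinity.\<close>

lemma integrable_pow_dom: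
  assumes "real l < p" "p < real l + 1"
  shows "integrable lborel (pow_dom p l)"
proof -
  let ?a = "\<lambda>t::real. indicator {0..1} t * t powr (real l - p)"
  let ?b = "\<lambda>t::real. indicator {1..} t * t powr (real l - p - 1)"
  have "((\<lambda>t. t powr (real l - p)) has_integral (1 powr (real l - p + 1) / (real l - p + 1))) {0..1}"
    using assms by (intro has_integral_powr_from_0) auto
  hence "(\<integral>\<^sup>+ t. ennreal (?a t) \<partial>lborel) = ennreal (1 powr (real l - p + 1) / (real l - p + 1))"
    by (intro nn_integral_has_integral_lebesgue) auto
  hence a: "integrable lborel ?a"
    by (intro integrableI_nonneg) auto
  have "((\<lambda>t. t powr (real l - p - 1)) has_integral (- (1 powr (real l - p - 1 + 1)) / (real l - p - 1 + 1))) {1..}"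
    using assms by (intro has_integral_powr_to_inf) auto
  hence "(\<integral>\<^sup>+ t. ennreal (?b t) \<partial>lborel) = ennreal (- (1 powr (real l - p - 1 + 1)) / (real l - p - 1 + 1))"
    by (intro nn_integral_has_integral_lebesgue) auto
  hence b: "integrable lborel ?b"
    by (intro integrableI_nonneg) auto
  show ?thesis
    by (rule Bochner_Integration.integrable_bound[OF Bochner_Integration.integrable_add[OF a b]])
       (auto simp: pow_dom_def indicator_def)
qed

lemma kern_measurable [measurable]:
  assumes [measurable]: "f \<in> borel_measurable M" "g \<in> borel_measurable M"
  shows "(\<lambda>w. kern p l (f w) (g w)) \<in> borel_measurable M"
proof -
  have [measurable]: "Re \<in> borel_measurable borel"
    by (intro borel_measurable_continuous_onI continuous_intros)
  show ?thesis
    unfolding kern_def exp_rem_def it_pow_def by measurable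
qed

lemma integrable_kern:
  assumes "real l < p" "p < real l + 1" "v \<ge> 0"
  shows "integrable lborel (\<lambda>t. indicator {v..} t * kern p l t x)"
  by (rule Bochner_Integration.integrable_bound[OF integrable_mult_right[OF integrable_pow_dom[OF assms(1,2)], of "2 * (\<bar>x\<bar> ^ l + \<bar>x\<bar> ^ Suc l)"]])
     (use assms abs_kern_le_pow_dom[of _ p l x] in \<open>auto simp: indicator_def abs_mult pow_dom_nonneg\<close>)

lemma Re_of_real_mult: "Re (complex_of_real a * z) = a * Re z"
  by simp

lemma kern_scale:
  assumes "c > 0" "t \<ge> 0"
  shows "kern p l t (c * x) = c powr (p + 1) * kern p l (c * t) x"
proof -
  have "it_pow p (c * t) = of_real (c powr (p + 1)) * it_pow p t"
    using assms by (simp add: it_pow_def powr_mult)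
  moreover have "t * (c * x) = c * t * x" by simp
  ultimately have E: "of_real (c powr (p + 1)) * (exp_rem l (\<i> * complex_of_real (c * t * x)) / it_pow p (c * t))
     = exp_rem l (\<i> * complex_of_real (t * (c * x))) / it_pow p t"
    using assms by (simp only:) simp
  from arg_cong[OF E, of Re] show ?thesis
    unfolding kern_def Re_of_real_mult by simp
qed

text \<open>The kernel is homogeneous of degree p + 1 and the substitution in t costs one factor c.
  The identity is used in two ways: to move the cutoff to 1, and to move x to 1 or -1.\<close>

lemma trunc_int_scale:
  assumes "c > 0" "v \<ge> 0"
  shows "trunc_int p l v (c * x) = c powr p * trunc_int p l (c * v) x"
proof -
  have "trunc_int p l (c * v) x = c * (\<integral>t. indicator {c * v..} (c * t) * kern p l (c * t) x \<partial>lborel)"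
    unfolding trunc_int_def using assms
    by (subst lborel_integral_real_affine[where c = c and t = 0]) auto
  hence "c powr p * trunc_int p l (c * v) x = (\<integral>t. c powr (p + 1) * (indicator {c * v..} (c * t) * kern p l (c * t) x) \<partial>lborel)"
    using assms by (simp add: powr_add)
  also have "\<dots> = trunc_int p l v (c * x)"
    unfolding trunc_int_def
    by (intro Bochner_Integration.integral_cong)
       (use assms in \<open>auto simp: indicator_def kern_scale\<close>)
  finally show ?thesis by simp
qed

text \<open>Scaling to \<open>sgn x\<close> leaves an integral bounded independently of the cutoff;
  uniformity in v is what lets |x|^p act as a dominating function as v tends to 0. The constant is 4
  because both powers of |\<open>sgn x\<close>| equal 1.\<close>

lemma abs_trunc_int_le:
  assumes "real l < p" "p < real l + 1" "v \<ge> 0"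
  shows "\<bar>trunc_int p l v x\<bar> \<le> 4 * integral\<^sup>L lborel (pow_dom p l) * \<bar>x\<bar> powr p"
proof (cases "x = 0")
  case True
  thus ?thesis by (simp add: trunc_int_def)
next
  case False
  have "norm (trunc_int p l (\<bar>x\<bar> * v) (sgn x)) \<le> (\<integral>t. 4 * pow_dom p l t \<partial>lborel)"
    unfolding trunc_int_def
  proof (rule Bochner_Integration.integral_norm_bound_integral)
    fix t
    show "norm (indicator {\<bar>x\<bar> * v..} t * kern p l t (sgn x)) \<le> 4 * pow_dom p l t"
      using abs_kern_le_pow_dom[of t p l "sgn x"] False order.trans[OF mult_nonneg_nonneg[of "\<bar>x\<bar>" v], of t] assms
      by (cases "t \<ge> \<bar>x\<bar> * v") (simp_all add: pow_dom_nonneg abs_sgn_eq)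
  qed (use assms in \<open>auto intro!: integrable_kern integrable_pow_dom\<close>)
  hence "\<bar>x\<bar> powr p * \<bar>trunc_int p l (\<bar>x\<bar> * v) (sgn x)\<bar> \<le> \<bar>x\<bar> powr p * (4 * integral\<^sup>L lborel (pow_dom p l))"
    by (intro mult_left_mono) auto
  moreover have "trunc_int p l v (\<bar>x\<bar> * sgn x) = \<bar>x\<bar> powr p * trunc_int p l (\<bar>x\<bar> * v) (sgn x)"
    using False assms by (intro trunc_int_scale) auto
  ultimately show ?thesis by (simp add: abs_mult_sgn abs_mult mult_ac)
qed

lemma trunc_int_tendsto:
  assumes "real l < p" "p < real l + 1"
  shows "((\<lambda>v. trunc_int p l v x) \<longlongrightarrow> trunc_int p l 0 x) (at_right 0)"
proof (rule tendsto_at_right_sequentially[of 0 1])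
  fix S :: "nat \<Rightarrow> real"
  assume S: "\<And>n. 0 < S n" "S \<longlonglongrightarrow> 0"
  show "(\<lambda>n. trunc_int p l (S n) x) \<longlonglongrightarrow> trunc_int p l 0 x"
    unfolding trunc_int_def
  proof (rule integral_dominated_convergence[where w = "\<lambda>t. 2 * (\<bar>x\<bar> ^ l + \<bar>x\<bar> ^ Suc l) * pow_dom p l t"])
    show "integrable lborel (\<lambda>t. 2 * (\<bar>x\<bar> ^ l + \<bar>x\<bar> ^ Suc l) * pow_dom p l t)"
      by (intro integrable_mult_right integrable_pow_dom assms)
    show "AE t in lborel. norm (indicator {S n..} t * kern p l t x) \<le> 2 * (\<bar>x\<bar> ^ l + \<bar>x\<bar> ^ Suc l) * pow_dom p l t" for n
      using S(1)[of n] abs_kern_le_pow_dom[of _ p l x] by (intro always_eventually allI) (auto simp: indicator_def pow_dom_nonneg)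
    show "AE t in lborel. (\<lambda>n. indicator {S n..} t * kern p l t x) \<longlonglongrightarrow> indicator {0..} t * kern p l t x"
    proof (intro always_eventually allI)
      fix t :: real
      show "(\<lambda>n. indicator {S n..} t * kern p l t x) \<longlonglongrightarrow> indicator {0..} t * kern p l t x"
      proof (cases "t > 0")
        case True
        have "\<forall>\<^sub>F n in sequentially. S n < t" using order_tendstoD(2)[OF S(2) True] .
        hence "\<forall>\<^sub>F n in sequentially. indicator {S n..} t * kern p l t x = indicator {0..} t * kern p l t x"
          by eventually_elim (use True in \<open>auto simp: indicator_def\<close>)
        thus ?thesis by (rule tendsto_eventually)
      next
        case False
        \<comment> \<open>At t = 0 the two indicators differ, but the kernel vanishes there by the
          convention on division by 0.\<close>
        have "indicator {S n..} t * kern p l t x = indicator {0..} t * kern p l t x" for n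
          using S(1)[of n] False by (cases "t = 0") (auto simp: indicator_def)
        thus ?thesis by (simp only: tendsto_const)
      qed
    qed
  qed auto
qed simp

lemma trunc_int_measurable [measurable]: "trunc_int p l v \<in> borel_measurable borel"
  unfolding trunc_int_def[abs_def] by measurable

section \<open>Lowering p and l by differentiation in x\<close>

lemma exp_rem_has_field_derivative:
  "(exp_rem (Suc l) has_field_derivative exp_rem l z) (at z)"
proof -
  have "((\<lambda>z. exp z - (\<Sum>j\<le>Suc l. z ^ j / of_nat (fact j))) has_field_derivative
     exp z - (\<Sum>j\<le>Suc l. of_nat j * z ^ (j - 1) / of_nat (fact j))) (at z)"
    by (intro DERIV_diff DERIV_exp DERIV_sum DERIV_cdivide) (use DERIV_power[OF DERIV_ident, where x=z and s=UNIV] in simp)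
  also have "(\<Sum>j\<le>Suc l. of_nat j * z ^ (j - 1) / of_nat (fact j)) = (\<Sum>j\<le>l. z ^ j / of_nat (fact j))"
  proof -
    have "(\<Sum>j\<le>Suc l. of_nat j * z ^ (j - 1) / of_nat (fact j)) = (\<Sum>j\<le>l. of_nat (Suc j) * z ^ j / of_nat (fact (Suc j)))"
      by (subst sum.atMost_Suc_shift) simp
    also have "\<dots> = (\<Sum>j\<le>l. z ^ j / of_nat (fact j))"
    proof (intro sum.cong refl)
      fix j
      show "of_nat (Suc j) * z ^ j / of_nat (fact (Suc j)) = z ^ j / of_nat (fact j)"
        by (simp only: fact_Suc of_nat_mult of_nat_id) (simp del: of_nat_Suc)
    qed
    finally show ?thesis .
  qed
  finally show ?thesis by (simp add: exp_rem_def[abs_def])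
qed

text \<open>The chain rule produces a factor \<open>\<i> * t\<close>, which cancels against the
  extra factor in (it)^(p+2); only \<sigma> survives. Taking \<sigma> = 1 or -1 treats both
  half-lines with a variable y >= 0.\<close>

lemma kern_has_derivative:
  assumes "t > 0"
  shows "((\<lambda>y. kern (p + 1) (Suc l) t (\<sigma> * y)) has_real_derivative \<sigma> * kern p l t (\<sigma> * y)) (at y within A)"
proof -
  have it: "it_pow (p + 1) t = \<i> * of_real t * it_pow p t"
  proof -
    have "cis (pi * (p + 1 + 1) / 2) = \<i> * cis (pi * (p + 1) / 2)"
    proof -
      have "cis (pi * (p + 1 + 1) / 2) = cis (pi / 2 + pi * (p + 1) / 2)"
        by (rule arg_cong[of _ _ cis]) (simp add: field_simps)
      also have "\<dots> = \<i> * cis (pi * (p + 1) / 2)"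
        by (simp only: cis_mult[symmetric] cis_pi_half)
      finally show ?thesis .
    qed
    moreover have "t powr (p + 1 + 1) = t * t powr (p + 1)" 
      using assms by (simp only: powr_add[of t "p + 1"]) simp
    ultimately show ?thesis by (simp only: it_pow_def of_real_mult) simp
  qed
  let ?f = "\<lambda>z. exp_rem (Suc l) (\<i> * complex_of_real (t * \<sigma>) * z) / it_pow (p + 1) t"
  have nz: "it_pow p t \<noteq> 0" using assms by (simp add: it_pow_def)
  have "(?f has_field_derivative (exp_rem l (\<i> * complex_of_real (t * \<sigma>) * of_real y) * (\<i> * complex_of_real (t * \<sigma>)) / it_pow (p + 1) t)) (at (of_real y))"
    by (intro DERIV_cdivide DERIV_chain2[OF exp_rem_has_field_derivative] derivative_eq_intros) auto
  from has_vector_derivative_real_field[OF this]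
  have "((\<lambda>y. ?f (of_real y)) has_vector_derivative 
     (exp_rem l (\<i> * complex_of_real (t * \<sigma>) * of_real y) * (\<i> * complex_of_real (t * \<sigma>)) / it_pow (p + 1) t)) (at y within A)" .
  from bounded_linear.has_vector_derivative[OF bounded_linear_Re this]
  have "((\<lambda>y. Re (?f (of_real y))) has_real_derivative 
     Re (exp_rem l (\<i> * complex_of_real (t * \<sigma>) * of_real y) * (\<i> * complex_of_real (t * \<sigma>)) / it_pow (p + 1) t)) (at y within A)"
    by (simp add: has_real_derivative_iff_has_vector_derivative)
  also have "exp_rem l (\<i> * complex_of_real (t * \<sigma>) * of_real y) * (\<i> * complex_of_real (t * \<sigma>)) / it_pow (p + 1) t
     = of_real \<sigma> * (exp_rem l (\<i> * complex_of_real (t * (\<sigma> * y))) / it_pow p t)"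
    using assms nz unfolding it by (simp add: field_simps)
  also have "Re \<dots> = \<sigma> * kern p l t (\<sigma> * y)"
    by (simp only: kern_def Re_of_real_mult)
  also have "(\<lambda>y. Re (?f (of_real y))) = (\<lambda>y. kern (p + 1) (Suc l) t (\<sigma> * y))"
    by (simp add: kern_def mult_ac)
  finally show ?thesis .
qed

lemma continuous_on_kern: "continuous_on A (\<lambda>y. kern p l t (\<sigma> * y))"
  unfolding kern_def exp_rem_def divide_inverse by (intro continuous_intros)

text \<open>For fixed t the fundamental theorem of calculus applies, the kernel being 0 at y = 0;
  Fubini then moves the integral over t inside. The case v = 0 is included, so the recursion serves
  both T 0 and T 1.\<close>

lemma trunc_int_Suc:
  assumes "real l < p" "p < real l + 1" "v \<ge> 0" "x \<ge> 0"
  shows "integrable lborel (\<lambda>y. indicator {0..x} y * trunc_int p l v (\<sigma> * y))"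
    and "trunc_int (p + 1) (Suc l) v (\<sigma> * x) = \<sigma> * (\<integral>y. indicator {0..x} y * trunc_int p l v (\<sigma> * y) \<partial>lborel)"
proof -
  let ?f = "\<lambda>y t. indicator {0..x} y * (indicator {v..} t * kern p l t (\<sigma> * y))"
  \<comment> \<open>The majorant of the kernel at the end point y = x, valid for every y in
    [0, x].\<close>
  define C where "C = 2 * (\<bar>\<sigma> * x\<bar> ^ l + \<bar>\<sigma> * x\<bar> ^ Suc l)"
  have C: "C \<ge> 0" by (simp add: C_def)
  have bound: "\<bar>?f y t\<bar> \<le> indicator {0..x} y * (C * pow_dom p l t)" for y t
  proof (cases "y \<in> {0..x} \<and> t \<ge> v")
    case True
    have "\<bar>kern p l t (\<sigma> * y)\<bar> \<le> 2 * (\<bar>\<sigma> * y\<bar> ^ l + \<bar>\<sigma> * y\<bar> ^ Suc l) * pow_dom p l t"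
      using True assms by (intro abs_kern_le_pow_dom) auto
    also have "\<dots> \<le> C * pow_dom p l t"
      unfolding C_def using True
      by (intro mult_right_mono mult_left_mono add_mono power_mono pow_dom_nonneg) (auto simp: abs_mult intro!: mult_left_mono)
    finally show ?thesis using True by simp
  next
    case False
    thus ?thesis using C by (auto simp: indicator_def pow_dom_nonneg)
  qed
  have ik: "integrable lborel (\<lambda>t. ?f y t)" for y
    by (intro integrable_mult_right integrable_kern assms)
  have int: "integrable (lborel \<Otimes>\<^sub>M lborel) (case_prod ?f)"
  proof (rule lborel_pair.Fubini_integrable)
    show "integrable lborel (\<lambda>y. \<integral>t. norm (case_prod ?f (y, t)) \<partial>lborel)"
    proof (rule Bochner_Integration.integrable_bound)
      show "integrable lborel (\<lambda>y. indicator {0..x} y * (C * integral\<^sup>L lborel (pow_dom p l)))"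
        using assms by (intro integrable_mult_left integrable_real_indicator) auto
      show "AE y in lborel. norm (\<integral>t. norm (case_prod ?f (y, t)) \<partial>lborel) \<le> norm (indicator {0..x} y * (C * integral\<^sup>L lborel (pow_dom p l)))"
      proof (intro always_eventually allI)
        fix y
        have "(\<integral>t. norm (?f y t) \<partial>lborel) \<le> (\<integral>t. indicator {0..x} y * (C * pow_dom p l t) \<partial>lborel)"
          using bound[of y] 
          by (intro integral_mono) (auto intro!: integrable_mult_right integrable_pow_dom integrable_abs ik assms)
        moreover have "(\<integral>t. norm (?f y t) \<partial>lborel) \<ge> 0" by simp
        ultimately show "norm (\<integral>t. norm (case_prod ?f (y, t)) \<partial>lborel) \<le> norm (indicator {0..x} y * (C * integral\<^sup>L lborel (pow_dom p l)))"
          by simp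
      qed
    qed measurable
  qed (use ik in auto)
  have eq: "(\<integral>t. ?f y t \<partial>lborel) = indicator {0..x} y * trunc_int p l v (\<sigma> * y)" for y
    by (simp add: trunc_int_def)
  show "integrable lborel (\<lambda>y. indicator {0..x} y * trunc_int p l v (\<sigma> * y))"
    using lborel_pair.integrable_fst'[OF int] by (simp only: prod.case eq)
  have "trunc_int (p + 1) (Suc l) v (\<sigma> * x) = (\<integral>t. \<sigma> * (\<integral>y. ?f y t \<partial>lborel) \<partial>lborel)"
    unfolding trunc_int_def
  proof (rule Bochner_Integration.integral_cong[OF refl])
    fix t :: real
    show "indicator {v..} t * kern (p + 1) (Suc l) t (\<sigma> * x) = \<sigma> * (\<integral>y. ?f y t \<partial>lborel)"
    proof (cases "t \<ge> v \<and> t > 0")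
      case True
      have "(\<integral>y. indicator {0..x} y *\<^sub>R (\<sigma> * kern p l t (\<sigma> * y)) \<partial>lborel)
          = kern (p + 1) (Suc l) t (\<sigma> * x) - kern (p + 1) (Suc l) t (\<sigma> * 0)"
        using assms True kern_has_derivative[of t p l \<sigma>]
        by (intro integral_FTC_atLeastAtMost)
           (auto simp: has_real_derivative_iff_has_vector_derivative[symmetric] intro!: continuous_intros continuous_on_kern)
      moreover have "\<sigma> * (\<integral>y. ?f y t \<partial>lborel) = (\<integral>y. indicator {0..x} y *\<^sub>R (\<sigma> * kern p l t (\<sigma> * y)) \<partial>lborel)"
        
        unfolding integral_mult_right_zero[symmetric] using True by (intro Bochner_Integration.integral_cong) auto
      ultimately show ?thesis using True by simp
    next
      case False
      thus ?thesis using assms by (cases "t = 0") (auto simp: indicator_def)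
    qed
  qed
  also have "\<dots> = \<sigma> * (\<integral>y. (\<integral>t. ?f y t \<partial>lborel) \<partial>lborel)"
    by (simp add: lborel_pair.Fubini_integral[OF int])
  finally show "trunc_int (p + 1) (Suc l) v (\<sigma> * x) = \<sigma> * (\<integral>y. indicator {0..x} y * trunc_int p l v (\<sigma> * y) \<partial>lborel)"
    by (simp only: eq)
qed

section \<open>The case p < 1\<close>

text \<open>Division by \<open>it_pow p t\<close> rotates cis(tx) and 1 by -(pi p/2 + pi/2); the
  quarter turn makes sines of the cosines. For x = 1 and x = -1 the bracket is sin(t + \<phi>) - sin
  \<phi> up to sign, with \<phi> = -pi p/2 and \<phi> = pi p/2 respectively.\<close>

lemma kern_0_eq:
  "kern p 0 t x = t powr (- p - 1) * (sin (t * x - pi * p / 2) + sin (pi * p / 2))"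
proof -
  define \<theta> where "\<theta> = pi * p / 2"
  have a: "pi * (p + 1) / 2 = \<theta> + pi / 2" by (simp add: \<theta>_def field_simps)
  have "exp_rem 0 (\<i> * complex_of_real (t * x)) = cis (t * x) - cis 0"
    by (simp add: exp_rem_def cis_conv_exp)
  hence "exp_rem 0 (\<i> * complex_of_real (t * x)) / it_pow p t
      = of_real (inverse (t powr (p + 1))) * ((cis (t * x) - cis 0) / cis (\<theta> + pi / 2))"
    unfolding it_pow_def a of_real_inverse by (simp only: divide_inverse inverse_mult_distrib mult_ac)
  also have "(cis (t * x) - cis 0) / cis (\<theta> + pi / 2) = cis (t * x - (\<theta> + pi / 2)) - cis (0 - (\<theta> + pi / 2))"
    by (simp only: diff_divide_distrib cis_divide)
  finally have "kern p 0 t x = inverse (t powr (p + 1)) * Re (cis (t * x - (\<theta> + pi / 2)) - cis (0 - (\<theta> + pi / 2)))"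
    unfolding kern_def by (simp only: Re_of_real_mult)
  also have "Re (cis (t * x - (\<theta> + pi / 2)) - cis (0 - (\<theta> + pi / 2))) = cos (t * x - \<theta> - pi / 2) - cos (\<theta> + pi / 2)"
    by (simp add: algebra_simps cos_minus[of "\<theta> + pi / 2", symmetric] del: cos_minus)
  also have "\<dots> = sin (t * x - \<theta>) + sin \<theta>"
    by (simp only: cos_diff[of "t * x - \<theta>"] cos_add[of \<theta>]) simp
  also have "inverse (t powr (p + 1)) = t powr (- p - 1)"
    unfolding powr_minus[symmetric] by (rule arg_cong[of _ _ "(powr) t"]) simp
  finally show ?thesis by (simp only: \<theta>_def)
qed

section \<open>Laplace representation and the value of T 0 for p < 1\<close>

lemma abs_sin_shift_le: "\<bar>sin (s + \<phi>) - sin \<phi>\<bar> \<le> \<bar>s\<bar>" for s \<phi> :: real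
proof -
  have "\<bar>sin (s + \<phi>) - sin \<phi>\<bar> = 2 * \<bar>sin (s / 2)\<bar> * \<bar>cos ((s + \<phi> + \<phi>) / 2)\<bar>"
    by (subst sin_diff_sin) (simp add: abs_mult)
  also have "\<dots> \<le> 2 * \<bar>s / 2\<bar> * 1"
    by (intro mult_mono mult_nonneg_nonneg abs_sin_x_le_abs_x) auto
  finally show ?thesis by simp
qed

lemma abs_sin_shift_le_2: "\<bar>sin (s + \<phi>) - sin \<phi>\<bar> \<le> 2" for s \<phi> :: real
  using abs_sin_le_one[of "s + \<phi>"] abs_sin_le_one[of \<phi>] by linarith

text \<open>A shift a >= 0 only lowers the weight, so one majorant justifies Fubini below for all
  a.\<close>

lemma powr_sin_shift_le_pow_dom:
  assumes "0 < p" "s > 0" "a \<ge> 0"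
  shows "(s + a) powr (- p - 1) * \<bar>sin (s + \<phi>) - sin \<phi>\<bar> \<le> 2 * pow_dom p 0 s"
proof -
  have 1: "(s + a) powr (- p - 1) \<le> s powr (- p - 1)"
    using assms by (intro powr_mono2') auto
  show ?thesis
  proof (cases "s \<le> 1")
    case True
    have "(s + a) powr (- p - 1) * \<bar>sin (s + \<phi>) - sin \<phi>\<bar> \<le> s powr (- p - 1) * s"
      using abs_sin_shift_le[of s \<phi>] assms by (intro mult_mono 1) auto
    also have "\<dots> = s powr (- p)" using assms by (simp add: powr_mult_base mult.commute)
    also have "\<dots> \<le> 2 * s powr (- p)" by simp
    finally show ?thesis using assms True by (simp add: pow_dom_def)
  next
    case False
    have "(s + a) powr (- p - 1) * \<bar>sin (s + \<phi>) - sin \<phi>\<bar> \<le> s powr (- p - 1) * 2"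
      using abs_sin_shift_le_2[of s \<phi>] by (intro mult_mono 1) auto
    thus ?thesis using assms False by (simp add: pow_dom_def)
  qed
qed

text \<open>The Gamma integral writes Gamma(p+1) (s+a)^(-p-1) as the integral of u^p exp(-(s+a)u)
  over u > 0. After the exchange the integral over s is elementary. Here a is the cutoff, and its
  only trace on the Laplace side is the weight exp(-au).\<close>

lemma
  fixes p a \<phi> :: real
  assumes p: "0 < p" "p < 1" and a: "a \<ge> 0"
  shows integrable_laplace_sin_shift:
    "integrable lborel (\<lambda>u. indicator {0<..} u * (exp (- (a * u)) * (u powr (p - 1) * (u * cos \<phi> - sin \<phi>) / (u\<^sup>2 + 1))))"
    and powr_sin_shift_eq_laplace:
    "Gamma (p + 1) * (\<integral>s. indicator {0<..} s * ((s + a) powr (- p - 1) * (sin (s + \<phi>) - sin \<phi>)) \<partial>lborel)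
      = (\<integral>u. indicator {0<..} u * (exp (- (a * u)) * (u powr (p - 1) * (u * cos \<phi> - sin \<phi>) / (u\<^sup>2 + 1))) \<partial>lborel)"
proof -
  let ?h = "\<lambda>s. sin (s + \<phi>) - sin \<phi>"
  let ?f = "\<lambda>s u. indicator {0<..} s * indicator {0<..} u * (u powr p * exp (- ((s + a) * u)) * ?h s)"
  have G: "Gamma (p + 1) > 0" using p by (intro Gamma_real_pos) auto
  have 1: "has_bochner_integral lborel (\<lambda>u. ?f s u) (indicator {0<..} s * (?h s * (Gamma (p + 1) * (s + a) powr (- (p + 1)))))" for s
  proof (cases "s > 0")
    case True
    have "has_bochner_integral lborel (\<lambda>u. ?h s * (indicator {0<..} u * (u powr (p + 1 - 1) * exp (- ((s + a) * u)))))
       (?h s * (Gamma (p + 1) * (s + a) powr (- (p + 1))))"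
      using True a p by (intro has_bochner_integral_mult_right has_bochner_integral_Gamma_scaled) auto
    thus ?thesis using True by (simp add: mult_ac)
  qed (simp add: has_bochner_integral_zero)
  have 2: "(\<integral>u. norm (?f s u) \<partial>lborel) = indicator {0<..} s * (\<bar>?h s\<bar> * (Gamma (p + 1) * (s + a) powr (- (p + 1))))" for s
  proof (cases "s > 0")
    case True
    have "has_bochner_integral lborel (\<lambda>u. \<bar>?h s\<bar> * (indicator {0<..} u * (u powr (p + 1 - 1) * exp (- ((s + a) * u)))))
       (\<bar>?h s\<bar> * (Gamma (p + 1) * (s + a) powr (- (p + 1))))"
      using True a p by (intro has_bochner_integral_mult_right has_bochner_integral_Gamma_scaled) auto
    from has_bochner_integral_integral_eq[OF this] show ?thesis using True by (simp add: mult_ac abs_mult)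
  qed simp
  have int: "integrable (lborel \<Otimes>\<^sub>M lborel) (case_prod ?f)"
  proof (rule lborel_pair.Fubini_integrable)
    show "integrable lborel (\<lambda>s. \<integral>u. norm (case_prod ?f (s, u)) \<partial>lborel)"
      unfolding prod.case 2
    proof (rule Bochner_Integration.integrable_bound)
      show "integrable lborel (\<lambda>s. Gamma (p + 1) * (2 * pow_dom p 0 s))"
        using p by (intro integrable_mult_right integrable_pow_dom) auto
      show "AE s in lborel. norm (indicator {0<..} s * (\<bar>?h s\<bar> * (Gamma (p + 1) * (s + a) powr (- (p + 1)))))
          \<le> norm (Gamma (p + 1) * (2 * pow_dom p 0 s))"
      proof (intro always_eventually allI)
        fix s
        show "norm (indicator {0<..} s * (\<bar>?h s\<bar> * (Gamma (p + 1) * (s + a) powr (- (p + 1)))))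
          \<le> norm (Gamma (p + 1) * (2 * pow_dom p 0 s))"
        proof (cases "s > 0")
          case True
          from mult_left_mono[OF powr_sin_shift_le_pow_dom[OF p(1) True a, of \<phi>], of "Gamma (p + 1)"]
          show ?thesis using G True by (simp add: pow_dom_nonneg abs_mult mult_ac)
        qed simp
      qed
    qed measurable
  qed (use 1 in \<open>auto simp: has_bochner_integral_iff\<close>)
  have 3: "(\<integral>s. ?f s u \<partial>lborel) = indicator {0<..} u * (exp (- (a * u)) * (u powr (p - 1) * (u * cos \<phi> - sin \<phi>) / (u\<^sup>2 + 1)))" for u
  proof (cases "u > 0")
    case True
    have "has_bochner_integral lborel (\<lambda>s. (u powr p * exp (- (a * u))) * (indicator {0<..} s * (exp (- (u * s)) * ?h s)))
        ((u powr p * exp (- (a * u))) * ((u * cos \<phi> - sin \<phi>) / (u * (u\<^sup>2 + 1))))"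
      by (intro has_bochner_integral_mult_right has_bochner_integral_exp_sin_shift True)
    moreover have "(u powr p * exp (- (a * u))) * (indicator {0<..} s * (exp (- (u * s)) * ?h s)) = ?f s u" for s
      using True by (simp add: exp_add[symmetric] algebra_simps)
    ultimately have "(\<integral>s. ?f s u \<partial>lborel) = (u powr p * exp (- (a * u))) * ((u * cos \<phi> - sin \<phi>) / (u * (u\<^sup>2 + 1)))"
      by (simp only: has_bochner_integral_integral_eq)
    also have "\<dots> = exp (- (a * u)) * (u powr (p - 1) * (u * cos \<phi> - sin \<phi>) / (u\<^sup>2 + 1))"
    proof -
      have "u powr p = u * u powr (p - 1)" using True by (simp add: powr_mult_base)
      thus ?thesis using True by simp
    qed
    finally show ?thesis using True by simp
  qed simp
  show "integrable lborel (\<lambda>u. indicator {0<..} u * (exp (- (a * u)) * (u powr (p - 1) * (u * cos \<phi> - sin \<phi>) / (u\<^sup>2 + 1))))"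
    using lborel_pair.integrable_snd[OF int] by (simp only: 3)
  have "Gamma (p + 1) * (\<integral>s. indicator {0<..} s * ((s + a) powr (- p - 1) * (sin (s + \<phi>) - sin \<phi>)) \<partial>lborel)
     = (\<integral>s. (\<integral>u. ?f s u \<partial>lborel) \<partial>lborel)"
    unfolding has_bochner_integral_integral_eq[OF 1] integral_mult_right_zero[symmetric]
    by (intro Bochner_Integration.integral_cong) (auto simp: mult_ac)
  also have "\<dots> = (\<integral>u. (\<integral>s. ?f s u \<partial>lborel) \<partial>lborel)"
    by (rule lborel_pair.Fubini_integral[OF int, symmetric])
  finally show "Gamma (p + 1) * (\<integral>s. indicator {0<..} s * ((s + a) powr (- p - 1) * (sin (s + \<phi>) - sin \<phi>)) \<partial>lborel)
      = (\<integral>u. indicator {0<..} u * (exp (- (a * u)) * (u powr (p - 1) * (u * cos \<phi> - sin \<phi>) / (u\<^sup>2 + 1))) \<partial>lborel)"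
    unfolding 3 .
qed

text \<open>The numerator splits into two integrals of
  \<open>has_bochner_integral_powr_inverse_one_plus_square\<close>, with exponents p + 1 and p; p <
  1 keeps the first below 2.\<close>

lemma integral_powr_linear_over_square:
  fixes p \<phi> :: real
  assumes p: "0 < p" "p < 1"
  shows "(\<integral>u. indicator {0<..} u * (u powr (p - 1) * (u * cos \<phi> - sin \<phi>) / (u\<^sup>2 + 1)) \<partial>lborel)
      = cos \<phi> * (pi / (2 * cos (pi * p / 2))) - sin \<phi> * (pi / (2 * sin (pi * p / 2)))"
proof -
  have "pi * (p + 1) / 2 = pi * p / 2 + pi / 2" by (simp add: field_simps)
  hence c: "sin (pi * (p + 1) / 2) = cos (pi * p / 2)" by (simp only: sin_add) simp
  have "has_bochner_integral lborel (\<lambda>u. cos \<phi> * (indicator {0<..} u * (u powr (p + 1 - 1) / (1 + u\<^sup>2)))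
      - sin \<phi> * (indicator {0<..} u * (u powr (p - 1) / (1 + u\<^sup>2))))
     (cos \<phi> * (pi / (2 * sin (pi * (p + 1) / 2))) - sin \<phi> * (pi / (2 * sin (pi * p / 2))))"
    using p by (intro has_bochner_integral_diff has_bochner_integral_mult_right has_bochner_integral_powr_inverse_one_plus_square) auto
  moreover have "cos \<phi> * (indicator {0<..} u * (u powr (p + 1 - 1) / (1 + u\<^sup>2)))
      - sin \<phi> * (indicator {0<..} u * (u powr (p - 1) / (1 + u\<^sup>2))) 
     = indicator {0<..} u * (u powr (p - 1) * (u * cos \<phi> - sin \<phi>) / (u\<^sup>2 + 1))" for u :: real
  proof (cases "u > 0")
    case True
    hence "u powr p = u * u powr (p - 1)" by (simp add: powr_mult_base)
    thus ?thesis using True by (simp add: add.commute diff_divide_distrib[symmetric]) (simp add: algebra_simps)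
  qed simp
  ultimately show ?thesis unfolding c by (simp only: has_bochner_integral_integral_eq)
qed

text \<open>By scaling only x = 1 and x = -1 matter. The two terms pi/2 of the Laplace value add up
  for \<phi> = -\<theta> and cancel for \<phi> = \<theta>; the cancellation is why the negative
  half-line contributes nothing.\<close>

lemma trunc_int_base:
  assumes p: "0 < p" "p < 1"
  shows "trunc_int p 0 0 x = pi / Gamma (p + 1) * max 0 x powr p"
proof -
  define \<theta> where "\<theta> = pi * p / 2"
  have \<theta>: "0 < \<theta>" "\<theta> < pi / 2" using p by (auto simp: \<theta>_def)
  have nz: "sin \<theta> \<noteq> 0" "cos \<theta> \<noteq> 0"
    using sin_gt_zero[of \<theta>] cos_gt_zero[of \<theta>] \<theta> by auto
  have G: "Gamma (p + 1) > 0" using p by (intro Gamma_real_pos) auto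
  let ?I = "\<lambda>\<phi>. \<integral>s. indicator {0<..} s * ((s + 0) powr (- p - 1) * (sin (s + \<phi>) - sin \<phi>)) \<partial>lborel"
  have I: "Gamma (p + 1) * ?I \<phi> = cos \<phi> * (pi / (2 * cos \<theta>)) - sin \<phi> * (pi / (2 * sin \<theta>))" for \<phi>
    using powr_sin_shift_eq_laplace[OF p order.refl, of \<phi>] integral_powr_linear_over_square[OF p, of \<phi>]
    by (simp add: \<theta>_def)
  have "trunc_int p 0 0 1 = ?I (- \<theta>)"
    unfolding trunc_int_def 
    by (intro Bochner_Integration.integral_cong) (auto simp: kern_0_eq \<theta>_def indicator_def)
  also have "\<dots> = pi / Gamma (p + 1)"
    using I[of "- \<theta>"] nz G by (simp add: field_simps)
  finally have pos: "trunc_int p 0 0 1 = pi / Gamma (p + 1)" .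
  have "trunc_int p 0 0 (-1) = - ?I \<theta>"
    unfolding trunc_int_def Bochner_Integration.integral_minus[symmetric]
    by (intro Bochner_Integration.integral_cong) (auto simp: kern_0_eq \<theta>_def indicator_def sin_add sin_diff algebra_simps)
  also have "\<dots> = 0"
    using I[of "\<theta>"] nz G by simp
  finally have neg: "trunc_int p 0 0 (-1) = 0" .
  consider "x = 0" | "x > 0" | "x < 0" by linarith
  thus ?thesis
  proof cases
    case 1
    thus ?thesis by (simp add: trunc_int_def)
  next
    case 2
    thus ?thesis using trunc_int_scale[of x 0 p 0 1] pos by simp
  next
    case 3
    thus ?thesis using trunc_int_scale[of "- x" 0 p 0 "-1"] neg by simp
  qed
qed

section \<open>Sign of the truncated integral at x = -1 for p < 1\<close>

lemma sin_add_nat_2pi: "sin (x + 2 * pi * real k) = sin x"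
  using sin_2npi[of k] cos_2npi[of k] by (simp add: sin_add mult_ac)

text \<open>
  At multiples of \<open>2\<pi>\<close> the Laplace side has the integrand of the vanishing integral \<open>T 0 (-1)\<close> times
  \<open>exp (- a u)\<close>. That integrand changes sign only once, at \<open>u = tan \<theta>\<close>, so the decreasing weight can only
  tip the balance to the nonnegative side.
\<close>

lemma trunc_int_base_multiple_2pi:
  assumes p: "0 < p" "p < 1"
  shows "trunc_int p 0 (2 * pi * real k) (-1) \<ge> 0"
proof -
  define \<theta> where "\<theta> = pi * p / 2"
  have \<theta>: "0 < \<theta>" "\<theta> < pi / 2" using p by (auto simp: \<theta>_def)
  have sc: "sin \<theta> > 0" "cos \<theta> > 0"
    using sin_gt_zero[of \<theta>] cos_gt_zero[of \<theta>] \<theta> by auto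
  have G: "Gamma (p + 1) > 0" using p by (intro Gamma_real_pos) auto
  define a where "a = 2 * pi * real k"
  have a: "a \<ge> 0" by (simp add: a_def)
  define m where "m = sin \<theta> / cos \<theta>"
  \<comment> \<open>Moving the cutoff to 0 leaves the sines unchanged, because a is a multiple of 2
    pi; only the weight (s+a)^(-p-1) remembers a.\<close>
  have "trunc_int p 0 a (-1) = (\<integral>s. indicator {a..} (a + s) * kern p 0 (a + s) (-1) \<partial>lborel)"
    unfolding trunc_int_def by (subst lborel_integral_real_affine[where c = 1 and t = a]) auto
  also have "\<dots> = - (\<integral>s. indicator {0<..} s * ((s + a) powr (- p - 1) * (sin (s + \<theta>) - sin \<theta>)) \<partial>lborel)"
    unfolding Bochner_Integration.integral_minus[symmetric]
  proof (intro Bochner_Integration.integral_cong refl)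
    fix s :: real
    have "sin ((a + s) * (-1) - \<theta>) = - sin (s + \<theta> + 2 * pi * real k)"
      unfolding sin_minus[symmetric] by (rule arg_cong[of _ _ sin]) (simp add: a_def)
    also have "\<dots> = - sin (s + \<theta>)" by (simp only: sin_add_nat_2pi)
    finally show "indicator {a..} (a + s) * kern p 0 (a + s) (-1) = - (indicator {0<..} s * ((s + a) powr (- p - 1) * (sin (s + \<theta>) - sin \<theta>)))"
      unfolding kern_0_eq \<theta>_def[symmetric] by (auto simp: indicator_def algebra_simps)
  qed
  finally have T: "Gamma (p + 1) * trunc_int p 0 a (-1) = 
     - (\<integral>u. indicator {0<..} u * (exp (- (a * u)) * (u powr (p - 1) * (u * cos \<theta> - sin \<theta>) / (u\<^sup>2 + 1))) \<partial>lborel)"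
    using powr_sin_shift_eq_laplace[OF p a, of \<theta>] by simp
  \<comment> \<open>The weight is frozen at its value in the sign change u = m: left of m it shrinks
    and multiplies a negative factor, right of m it grows and multiplies a nonnegative one. What
    remains is a multiple of the integral for a = 0, which vanishes; the factor
    \<open>exp (- (0 * u))\<close> merely exhibits it as that instance.\<close>
  have "(\<integral>u. indicator {0<..} u * (exp (- (a * u)) * (u powr (p - 1) * (u * cos \<theta> - sin \<theta>) / (u\<^sup>2 + 1))) \<partial>lborel)
     \<le> (\<integral>u. exp (- (a * m)) * (indicator {0<..} u * (exp (- (0 * u)) * (u powr (p - 1) * (u * cos \<theta> - sin \<theta>) / (u\<^sup>2 + 1)))) \<partial>lborel)"
  proof (intro integral_mono integrable_mult_right integrable_laplace_sin_shift p a order.refl)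
    fix u :: real
    have *: "exp (- (a * u)) * (u * cos \<theta> - sin \<theta>) \<le> exp (- (a * m)) * (u * cos \<theta> - sin \<theta>)"
    proof (cases "u \<ge> m")
      case True
      hence "u * cos \<theta> - sin \<theta> \<ge> 0" using sc by (simp add: m_def field_simps)
      moreover have "exp (- (a * u)) \<le> exp (- (a * m))" using True a by (simp add: mult_left_mono)
      ultimately show ?thesis by (rule mult_right_mono[rotated])
    next
      case False
      hence "u * cos \<theta> - sin \<theta> \<le> 0" using sc by (simp add: m_def field_simps)
      moreover have "exp (- (a * m)) \<le> exp (- (a * u))" using False a by (simp add: mult_left_mono)
      ultimately show ?thesis by (rule mult_right_mono_neg[rotated])
    qed
    have "u powr (p - 1) / (u\<^sup>2 + 1) * (exp (- (a * u)) * (u * cos \<theta> - sin \<theta>)) \<le> u powr (p - 1) / (u\<^sup>2 + 1) * (exp (- (a * m)) * (u * cos \<theta> - sin \<theta>))"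
      by (intro mult_left_mono *) auto
    thus "indicator {0<..} u * (exp (- (a * u)) * (u powr (p - 1) * (u * cos \<theta> - sin \<theta>) / (u\<^sup>2 + 1)))
       \<le> exp (- (a * m)) * (indicator {0<..} u * (exp (- (0 * u)) * (u powr (p - 1) * (u * cos \<theta> - sin \<theta>) / (u\<^sup>2 + 1))))"
      by (auto simp: indicator_def mult_ac)
  qed
  also have "\<dots> = 0"
    unfolding integral_mult_right_zero
    using integral_powr_linear_over_square[OF p, of \<theta>] sc by (simp flip: \<theta>_def)
  finally have "Gamma (p + 1) * trunc_int p 0 a (-1) \<ge> 0" unfolding T by simp
  thus ?thesis using G by (simp add: zero_le_mult_iff a_def)
qed

text \<open>Raising the cutoff from v to w removes the integral of the kernel over [v, w), so its
  sign there decides the monotonicity.\<close>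

lemma trunc_int_mono_nonneg:
  assumes "real l < p" "p < real l + 1" "0 \<le> v" "v \<le> w"
    and "\<And>s. v \<le> s \<Longrightarrow> s < w \<Longrightarrow> kern p l s x \<ge> 0"
  shows "trunc_int p l w x \<le> trunc_int p l v x"
  unfolding trunc_int_def using assms
  by (intro integral_mono integrable_kern) (auto simp: indicator_def)

text \<open>The counterpart for a negative kernel, with a guaranteed gain; m = 0 gives plain
  monotonicity.\<close>

lemma trunc_int_mono_le:
  assumes "real l < p" "p < real l + 1" "0 \<le> v" "v \<le> w"
    and "\<And>s. v \<le> s \<Longrightarrow> s < w \<Longrightarrow> kern p l s x \<le> - m"
  shows "trunc_int p l v x + m * (w - v) \<le> trunc_int p l w x"
proof -
  have "integrable lborel (\<lambda>s. m * indicator {v..<w} s)"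
    using assms by (intro integrable_mult_right integrable_real_indicator) auto
  hence "trunc_int p l v x + (\<integral>s. m * indicator {v..<w} s \<partial>lborel) = (\<integral>s. indicator {v..} s * kern p l s x + m * indicator {v..<w} s \<partial>lborel)"
    unfolding trunc_int_def using assms
    by (intro Bochner_Integration.integral_add[symmetric] integrable_kern) auto
  also have "\<dots> \<le> (\<integral>s. indicator {w..} s * kern p l s x \<partial>lborel)"
    using assms \<open>integrable lborel (\<lambda>s. m * indicator {v..<w} s)\<close>
    by (intro integral_mono Bochner_Integration.integrable_add integrable_kern) (auto simp: indicator_def le_diff_eq[symmetric])
  finally show ?thesis using assms by (simp add: trunc_int_def)
qed

text \<open>
  Between two multiples of \<open>2\<pi>\<close> the function \<open>v \<mapsto> T v (-1)\<close> first increases and then decreases, so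
  its minimum over the period is attained at an end point.
\<close>

lemma trunc_int_base_nonneg:
  assumes p: "0 < p" "p < 1" and v: "v \<ge> 0"
  shows "trunc_int p 0 v (-1) \<ge> 0"
proof -
  define \<theta> where "\<theta> = pi * p / 2"
  have \<theta>: "0 < \<theta>" "\<theta> < pi / 2" using p by (auto simp: \<theta>_def)
  define k where "k = nat \<lfloor>v / (2 * pi)\<rfloor>"
  have k: "2 * pi * real k \<le> v" "v < 2 * pi * real (Suc k)"
  proof -
    have "real k \<le> v / (2 * pi)" "v / (2 * pi) < real k + 1"
      using v unfolding k_def by (simp_all add: of_nat_nat)
    thus "2 * pi * real k \<le> v" "v < 2 * pi * real (Suc k)" by (simp_all add: field_simps)
  qed
  define r where "r = v - 2 * pi * real k"
  \<comment> \<open>The product formula exposes the signs: inside a period the sine is positive and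
    the cosine changes sign once, at y = pi - 2 \<theta>, so the kernel is first nonpositive and
    then nonnegative.\<close>
  have kern: "kern p 0 (2 * pi * real k + y) (-1) = - (2 * sin (y / 2) * cos (y / 2 + \<theta>) * (2 * pi * real k + y) powr (- p - 1))" for y
  proof -
    have "sin ((2 * pi * real k + y) * (-1) - \<theta>) = - sin (y + \<theta> + 2 * pi * real k)"
      unfolding sin_minus[symmetric] by (rule arg_cong[of _ _ sin]) simp
    also have "\<dots> = - sin (y + \<theta>)" by (simp only: sin_add_nat_2pi)
    also have "- sin (y + \<theta>) + sin \<theta> = - (2 * sin (y / 2) * cos (y / 2 + \<theta>))"
      using sin_diff_sin[of "y + \<theta>" \<theta>] by (simp add: add_divide_distrib add.commute)
    ultimately show ?thesis unfolding kern_0_eq \<theta>_def[symmetric] by simp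
  qed
  show ?thesis
  proof (cases "r \<le> pi - 2 * \<theta>")
    case True
    have "trunc_int p 0 (2 * pi * real k) (-1) + 0 * (v - 2 * pi * real k) \<le> trunc_int p 0 v (-1)"
    proof (rule trunc_int_mono_le)
      fix s assume s: "2 * pi * real k \<le> s" "s < v"
      define y where "y = s - 2 * pi * real k"
      have y: "0 \<le> y" "y \<le> pi - 2 * \<theta>" using s True by (auto simp: y_def r_def)
      have "sin (y / 2) \<ge> 0" using y \<theta> by (intro sin_ge_zero) auto
      moreover have "cos (y / 2 + \<theta>) \<ge> 0" using y \<theta> by (intro cos_ge_zero) auto
      ultimately show "kern p 0 s (-1) \<le> - 0" using kern[of y] by (simp add: y_def)
    qed (use p k in auto)
    thus ?thesis using trunc_int_base_multiple_2pi[OF p, of k] by simp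
  next
    case False
    have "trunc_int p 0 (2 * pi * real (Suc k)) (-1) \<le> trunc_int p 0 v (-1)"
    proof (rule trunc_int_mono_nonneg)
      fix s assume s: "v \<le> s" "s < 2 * pi * real (Suc k)"
      define y where "y = s - 2 * pi * real k"
      have y: "pi - 2 * \<theta> \<le> y" "y \<le> 2 * pi" using s False by (auto simp: y_def r_def algebra_simps)
      have "sin (y / 2) \<ge> 0" using y \<theta> by (intro sin_ge_zero) auto
      moreover have "cos (y / 2 + \<theta>) \<le> 0"
      proof -
        have "cos (y / 2 + \<theta> - pi) \<ge> 0" using y \<theta> by (intro cos_ge_zero) auto
        thus ?thesis by (simp add: cos_diff)
      qed
      ultimately show "kern p 0 s (-1) \<ge> 0" using kern[of y] by (simp add: y_def mult_nonneg_nonpos mult_nonpos_nonneg)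
    qed (use p k v in auto)
    thus ?thesis using trunc_int_base_multiple_2pi[OF p, of "Suc k"] by simp
  qed
qed

text \<open>On the initial stretch where the kernel at -1 is nonpositive, T v (-1) increases with v,
  starting from a nonnegative value. A strict gain before c therefore persists on all of [c, 2c],
  and scaling turns T x (-1) into T 1 (-x).\<close>

lemma trunc_int_base_lower_bound:
  assumes p: "0 < p" "p < 1"
  shows "\<exists>c>0. \<exists>\<delta>>0. \<forall>x\<in>{c..2*c}. trunc_int p 0 1 (-x) \<ge> \<delta>"
proof -
  define \<theta> where "\<theta> = pi * p / 2"
  have \<theta>: "0 < \<theta>" "\<theta> < pi / 2" using p by (auto simp: \<theta>_def)
  \<comment> \<open>Half of the first positive zero of the kernel, so that [0, 2c] stays in the
    region of nonpositive sign.\<close>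
  define c where "c = (pi - 2 * \<theta>) / 2"
  have c: "0 < c" "c < pi / 2" "2 * c = pi - 2 * \<theta>" using \<theta> by (auto simp: c_def)
  have kern: "kern p 0 y (-1) = - (2 * sin (y / 2) * cos (y / 2 + \<theta>) * y powr (- p - 1))" for y
  proof -
    have "sin (y * (-1) - \<theta>) = - sin (y + \<theta>)"
      unfolding sin_minus[symmetric] by (rule arg_cong[of _ _ sin]) simp
    also have "- sin (y + \<theta>) + sin \<theta> = - (2 * sin (y / 2) * cos (y / 2 + \<theta>))"
      using sin_diff_sin[of "y + \<theta>" \<theta>] by (simp add: add_divide_distrib add.commute)
    ultimately show ?thesis unfolding kern_0_eq \<theta>_def[symmetric] by simp
  qed
  \<comment> \<open>A lower bound of the negated kernel on [c/2, c): each factor is monotone and is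
    taken at its less favourable end, c/2 for the sine and c for the others.\<close>
  define m where "m = 2 * sin (c / 4) * cos (c / 2 + \<theta>) * c powr (- p - 1)"
  have "sin (c / 4) > 0" using c by (intro sin_gt_zero) auto
  moreover have "cos (c / 2 + \<theta>) > 0" using c \<theta> by (intro cos_gt_zero; linarith)
  ultimately have m: "m > 0" using c by (simp add: m_def)
  have "trunc_int p 0 (c / 2) (-1) + m * (c - c / 2) \<le> trunc_int p 0 c (-1)"
  proof (rule trunc_int_mono_le)
    fix s assume s: "c / 2 \<le> s" "s < c"
    have "m \<le> 2 * sin (s / 2) * cos (s / 2 + \<theta>) * s powr (- p - 1)"
      unfolding m_def
    proof (intro mult_mono mult_nonneg_nonneg)
      show "sin (c / 4) \<le> sin (s / 2)" using s c by (intro sin_monotone_2pi_le) auto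
      show "cos (c / 2 + \<theta>) \<le> cos (s / 2 + \<theta>)" using s c \<theta> by (intro cos_monotone_0_pi_le) auto
      show "c powr (- p - 1) \<le> s powr (- p - 1)" using s c p by (intro powr_mono2') auto
      show "0 \<le> sin (s / 2)" using s c by (intro sin_ge_zero) auto
      show "0 \<le> cos (s / 2 + \<theta>)" using s c \<theta> by (intro cos_ge_zero) auto
      show "0 \<le> cos (c / 2 + \<theta>)" using c \<theta> by (intro cos_ge_zero) auto
    qed (use s c in \<open>auto intro!: sin_ge_zero\<close>)
    thus "kern p 0 s (-1) \<le> - m" by (simp add: kern)
  qed (use c p in auto)
  hence H: "trunc_int p 0 c (-1) > 0"
    using trunc_int_base_nonneg[OF p, of "c / 2"] c(1) mult_pos_pos[OF m, of "c - c / 2"] by linarith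
  have "trunc_int p 0 1 (-x) \<ge> c powr p * trunc_int p 0 c (-1)" if x: "x \<in> {c..2*c}" for x
  proof -
    have "trunc_int p 0 c (-1) + 0 * (x - c) \<le> trunc_int p 0 x (-1)"
    proof (rule trunc_int_mono_le)
      fix s assume s: "c \<le> s" "s < x"
      have "sin (s / 2) \<ge> 0" using s c x by (intro sin_ge_zero) auto
      moreover have "cos (s / 2 + \<theta>) \<ge> 0" using s c x \<theta> by (intro cos_ge_zero) auto
      ultimately show "kern p 0 s (-1) \<le> - 0" by (simp add: kern)
    qed (use p c x in auto)
    hence "c powr p * trunc_int p 0 c (-1) \<le> x powr p * trunc_int p 0 x (-1)"
      using x c p H by (intro mult_mono powr_mono2) auto
    also have "\<dots> = trunc_int p 0 1 (-x)"
      using trunc_int_scale[of x 1 p 0 "-1"] x c by simp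
    finally show ?thesis .
  qed
  thus ?thesis using c H by (intro exI[of _ c] conjI exI[of _ "c powr p * trunc_int p 0 c (-1)"]) auto
qed

section \<open>Sign and size of the truncated integral\<close>

lemma has_bochner_integral_powr_Icc:
  fixes a x :: real
  assumes "a > -1" "x \<ge> 0"
  shows "has_bochner_integral lborel (\<lambda>y. indicator {0..x} y * y powr a) (x powr (a + 1) / (a + 1))"
  using nn_integral_has_integral_lebesgue[OF _ has_integral_powr_from_0[OF assms]] assms
  by (intro has_bochner_integral_nn_integral) auto

text \<open>In the induction, integrating y^q produces the divisor q + 1, which the functional
  equation of Gamma absorbs; on the negative half-line zero integrates to zero.\<close>

lemma trunc_int_zero_eq:
  assumes "real l < p" "p < real l + 1"
  shows "trunc_int p l 0 x = pi / Gamma (p + 1) * max 0 x powr p"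
  using assms
proof (induction l arbitrary: p x)
  case 0
  thus ?case by (intro trunc_int_base) auto
next
  case (Suc l)
  define q where "q = p - 1"
  have q: "real l < q" "q < real l + 1" "p = q + 1" using Suc.prems by (auto simp: q_def)
  have q0: "q > 0" using q(1) by linarith
  have "Gamma (q + 1 + 1) = (q + 1) * Gamma (q + 1)"
    using q0 by (intro Gamma_plus1) (auto elim!: nonpos_Ints_cases)
  hence G: "Gamma (q + 1 + 1) = (q + 1) * Gamma (q + 1)" "Gamma (q + 1) > 0"
    using q0 by (auto intro!: Gamma_real_pos)
  show ?case
  proof (cases "x \<ge> 0")
    case True
    have "trunc_int p (Suc l) 0 (1 * x) = 1 * (\<integral>y. indicator {0..x} y * trunc_int q l 0 (1 * y) \<partial>lborel)"
      unfolding q(3) by (rule trunc_int_Suc(2)) (use q True in auto)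
    also have "(\<integral>y. indicator {0..x} y * trunc_int q l 0 (1 * y) \<partial>lborel)
        = (\<integral>y. pi / Gamma (q + 1) * (indicator {0..x} y * y powr q) \<partial>lborel)"
      by (intro Bochner_Integration.integral_cong) (auto simp: Suc.IH[OF q(1,2)] indicator_def)
    also have "\<dots> = pi / Gamma (q + 1) * (x powr (q + 1) / (q + 1))"
      using q0 True has_bochner_integral_integral_eq[OF has_bochner_integral_powr_Icc[of q x]]
      by (simp only: integral_mult_right_zero)
    finally show ?thesis using True q0 G unfolding q(3) by (simp add: field_simps)
  next
    case False
    have "trunc_int p (Suc l) 0 ((-1) * (- x)) = (-1) * (\<integral>y. indicator {0..- x} y * trunc_int q l 0 ((-1) * y) \<partial>lborel)"
      unfolding q(3) by (rule trunc_int_Suc(2)) (use q False in auto)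
    also have "(\<integral>y. indicator {0..- x} y * trunc_int q l 0 ((-1) * y) \<partial>lborel) = (\<integral>y. 0 \<partial>(lborel :: real measure))"
      by (intro Bochner_Integration.integral_cong) (auto simp: Suc.IH[OF q(1,2)] indicator_def)
    finally show ?thesis using False by simp
  qed
qed

text \<open>Each integration along the negative axis contributes one factor -1, hence (-1)^l. Both
  claims go through one induction, since the lower bound needs nonnegativity off the distinguished
  interval.\<close>

lemma trunc_int_sign:
  assumes "real l < p" "p < real l + 1"
  shows "(\<forall>x\<ge>0. (-1) ^ l * trunc_int p l 1 (- x) \<ge> 0) \<and>
    (\<exists>c>0. \<exists>\<delta>>0. \<forall>x\<in>{c..2*c}. (-1) ^ l * trunc_int p l 1 (- x) \<ge> \<delta>)"
  using assms
proof (induction l arbitrary: p)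
  case 0
  hence p: "0 < p" "p < 1" by auto
  have "trunc_int p 0 1 (- x) \<ge> 0" if "x \<ge> 0" for x
  proof (cases "x = 0")
    case False
    with that trunc_int_scale[of x 1 p 0 "-1"] trunc_int_base_nonneg[OF p, of x] show ?thesis by simp
  qed (simp add: trunc_int_def)
  thus ?case using trunc_int_base_lower_bound[OF p] by simp
next
  case (Suc l)
  define q where "q = p - 1"
  have q: "real l < q" "q < real l + 1" "p = q + 1" using Suc.prems by (auto simp: q_def)
  let ?g = "\<lambda>y. (-1) ^ l * trunc_int q l 1 (- y)"
  from Suc.IH[OF q(1,2)] obtain c \<delta> where nn: "\<And>x. x \<ge> 0 \<Longrightarrow> ?g x \<ge> 0"
    and c: "c > 0" "\<delta> > 0" "\<And>x. x \<in> {c..2*c} \<Longrightarrow> ?g x \<ge> \<delta>" by blast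
  have int: "integrable lborel (\<lambda>y. indicator {0..x} y * ?g y)" if "x \<ge> 0" for x
    using integrable_mult_right[OF trunc_int_Suc(1)[OF q(1,2) _ that, of 1 "-1"], of "(-1) ^ l"]
    by (simp add: mult_ac)
  have eq: "(-1) ^ Suc l * trunc_int p (Suc l) 1 (- x) = (\<integral>y. indicator {0..x} y * ?g y \<partial>lborel)" if "x \<ge> 0" for x
  proof -
    have "trunc_int (q + 1) (Suc l) 1 ((-1) * x) = (-1) * (\<integral>y. indicator {0..x} y * trunc_int q l 1 ((-1) * y) \<partial>lborel)"
      by (rule trunc_int_Suc(2)) (use q that in auto)
    hence "(-1) ^ Suc l * trunc_int p (Suc l) 1 (- x) = (-1) ^ l * (\<integral>y. indicator {0..x} y * trunc_int q l 1 (- y) \<partial>lborel)"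
      unfolding q(3) by simp
    also have "\<dots> = (\<integral>y. indicator {0..x} y * ?g y \<partial>lborel)"
      unfolding integral_mult_right_zero[symmetric] by (simp only: mult_ac)
    finally show ?thesis .
  qed
  have "(-1) ^ Suc l * trunc_int p (Suc l) 1 (- x) \<ge> 0" if "x \<ge> 0" for x
    unfolding eq[OF that] using nn by (intro Bochner_Integration.integral_nonneg) (auto simp: indicator_def)
  \<comment> \<open>Once x >= 2c, the range [0, x] contains the whole of [c, 2c], whose contribution
    is at least \<delta> c. The interval for the next level is therefore [2c, 4c].\<close>
  moreover have "(-1) ^ Suc l * trunc_int p (Suc l) 1 (- x) \<ge> \<delta> * c" if x: "x \<in> {2*c..2*(2*c)}" for x
  proof -
    have x0: "x \<ge> 0" using x c by auto
    have "\<delta> * c = (\<integral>y. \<delta> * indicator {c..2*c} y \<partial>lborel)" using c by simp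
    also have "\<dots> \<le> (\<integral>y. indicator {0..x} y * ?g y \<partial>lborel)"
    proof (rule integral_mono[OF _ int[OF x0]])
      show "integrable lborel (\<lambda>y. \<delta> * indicator {c..2*c} y)"
        using c by (intro integrable_mult_right integrable_real_indicator) auto
      show "\<delta> * indicator {c..2*c} y \<le> indicator {0..x} y * ?g y" for y
        using x c(1,2) c(3)[of y] nn[of y] by (auto simp: indicator_def)
    qed
    finally show ?thesis unfolding eq[OF x0] .
  qed
  moreover have "2 * c > 0" "\<delta> * c > 0" using c by auto
  ultimately show ?case by blast
qed

text \<open>For y >= 0 this is min(y^l, y^(l+1)); for s > 0 it equals s^(p+1)
  \<open>pow_dom p l s\<close>, whatever p is.\<close>

definition pow_min :: "nat \<Rightarrow> real \<Rightarrow> real" where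
  "pow_min l y = (if y \<le> 1 then y ^ Suc l else y ^ l)"

lemma pow_min_measurable [measurable]: "pow_min l \<in> borel_measurable borel"
  unfolding pow_min_def[abs_def] by measurable

lemma pow_min_nonneg: "y \<ge> 0 \<Longrightarrow> 0 \<le> pow_min l y"
  by (simp add: pow_min_def)

lemma power_le_pow_min:
  assumes "y \<ge> 0"
  shows "y ^ l \<le> 1 + pow_min l y"
proof (cases "y \<le> 1")
  case True
  have "y ^ l \<le> 1" "0 \<le> y ^ Suc l" using assms True by (auto intro: power_le_one)
  thus ?thesis unfolding pow_min_def if_P[OF True] by linarith
qed (simp add: pow_min_def)

text \<open>A doubling property, which permits replacing a value at y by values on [y/2, y]. If the
  interval straddles 1, y^l <= y^(l+1) bridges the two branches.\<close>

lemma pow_min_half: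
  assumes "y > 0" "y / 2 \<le> s" "s \<le> y"
  shows "pow_min l y \<le> 2 ^ Suc l * pow_min l s"
proof -
  have s: "s > 0" using assms by simp
  have 1: "y ^ n \<le> 2 ^ n * s ^ n" for n
    unfolding power_mult_distrib[symmetric] using assms by (intro power_mono) auto
  have 2: "y ^ l \<le> 2 ^ Suc l * s ^ l"
  proof -
    have "2 ^ l * s ^ l \<le> 2 ^ Suc l * s ^ l" using s by (intro mult_right_mono) auto
    thus ?thesis using 1[of l] by linarith
  qed
  have 3: "y ^ l \<le> 2 ^ Suc l * s ^ Suc l" if "y > 1" 
  proof -
    have "y ^ l \<le> y ^ Suc l" using that by (intro power_increasing) auto
    thus ?thesis using 1[of "Suc l"] by linarith
  qed
  show ?thesis using 1[of "Suc l"] 2 3 assms by (auto simp: pow_min_def simp del: power_Suc)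
qed

lemma powr_pow_dom_eq: "s > 0 \<Longrightarrow> s powr p * pow_dom p l s = pow_min l s / s"
  by (auto simp: pow_dom_def pow_min_def powr_add[symmetric] powr_diff powr_realpow)

text \<open>An upper bound of layer cake type without differentiating across the kink at 1: the
  constant \<open>pow_min l y\<close> is averaged over [y/2, y), and the doubling property and 1/y
  <= 1/s bound the integrand. The factor 2^(l+2) is 2 from the length y/2 times 2^(l+1) from
  doubling.\<close>

lemma pow_min_le_nn_integral:
  assumes "y \<ge> 0"
  shows "ennreal (pow_min l y) \<le> (\<integral>\<^sup>+ s. ennreal (2 ^ (l + 2) * (s powr p * pow_dom p l s)) * indicator {..<y} s \<partial>lborel)"
proof (cases "y = 0")
  case False
  with assms have y: "y > 0" by simp
  have "ennreal (pow_min l y) = (\<integral>\<^sup>+ s. ennreal (2 * pow_min l y / y) * indicator {y / 2..<y} s \<partial>lborel)"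
    using y pow_min_nonneg[of y l] by (simp add: nn_integral_cmult ennreal_mult'[symmetric])
  also have "\<dots> \<le> (\<integral>\<^sup>+ s. ennreal (2 ^ (l + 2) * (s powr p * pow_dom p l s)) * indicator {..<y} s \<partial>lborel)"
  proof (intro nn_integral_mono)
    fix s
    show "ennreal (2 * pow_min l y / y) * indicator {y / 2..<y} s \<le> ennreal (2 ^ (l + 2) * (s powr p * pow_dom p l s)) * indicator {..<y} s"
    proof (cases "s \<in> {y / 2..<y}")
      case True
      hence s: "s > 0" using y by auto
      have "2 * pow_min l y / y \<le> 2 * (2 ^ Suc l * pow_min l s) / s"
        using True y s pow_min_half[of y s l] pow_min_nonneg[of s l]
        by (intro frac_le mult_left_mono mult_nonneg_nonneg) auto
      also have "\<dots> = 2 ^ (l + 2) * (s powr p * pow_dom p l s)"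
        using s by (simp add: powr_pow_dom_eq)
      finally show ?thesis using True by (simp add: ennreal_leI)
    qed simp
  qed
  finally show ?thesis .
qed (simp add: pow_min_def)

text \<open>For x > 1 the bound of order l on t >= 1 suffices. For x <= 1 the extra power comes from
  T 0 (-x) = 0: it turns T 1 (-x) into minus the integral over [0, 1), where the bound of order l +
  1 is integrable.\<close>

lemma abs_trunc_int_neg_le:
  assumes p: "real l < p" "p < real l + 1" and x: "x \<ge> 0"
  shows "\<bar>trunc_int p l 1 (- x)\<bar> \<le> 2 * integral\<^sup>L lborel (pow_dom p l) * pow_min l x"
proof (cases "x \<le> 1")
  case False
  have "norm (trunc_int p l 1 (- x)) \<le> (\<integral>t. 2 * x ^ l * pow_dom p l t \<partial>lborel)"
    unfolding trunc_int_def
  proof (rule Bochner_Integration.integral_norm_bound_integral)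
    fix t
    show "norm (indicator {1..} t * kern p l t (- x)) \<le> 2 * x ^ l * pow_dom p l t"
      using abs_kern_le_large[of t p l "- x"] x by (cases "t = 1") (auto simp: indicator_def pow_dom_nonneg pow_dom_def)
  qed (use p in \<open>auto intro!: integrable_kern integrable_pow_dom\<close>)
  thus ?thesis using False by (simp add: pow_min_def mult_ac)
next
  case True
  have "trunc_int p l 1 (- x) = trunc_int p l 1 (- x) - trunc_int p l 0 (- x)"
    using x by (simp add: trunc_int_zero_eq[OF p])
  also have "\<dots> = (\<integral>t. indicator {1..} t * kern p l t (- x) - indicator {0..} t * kern p l t (- x) \<partial>lborel)"
    unfolding trunc_int_def using p by (intro Bochner_Integration.integral_diff[symmetric] integrable_kern) auto
  finally have eq: "trunc_int p l 1 (- x) = \<dots>" .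
  have "norm (trunc_int p l 1 (- x)) \<le> (\<integral>t. x ^ Suc l * pow_dom p l t \<partial>lborel)"
    unfolding eq
  proof (rule Bochner_Integration.integral_norm_bound_integral)
    fix t
    show "norm (indicator {1..} t * kern p l t (- x) - indicator {0..} t * kern p l t (- x)) \<le> x ^ Suc l * pow_dom p l t"
      using abs_kern_le_small[of t p l "- x"] x by (cases "t = 0") (auto simp: indicator_def pow_dom_nonneg pow_dom_def)
  qed (use p in \<open>auto intro!: integrable_kern integrable_pow_dom Bochner_Integration.integrable_diff\<close>)
  also have "\<dots> = integral\<^sup>L lborel (pow_dom p l) * x ^ Suc l" by (simp only: integral_mult_right_zero) (rule mult.commute)
  also have "\<dots> \<le> 2 * integral\<^sup>L lborel (pow_dom p l) * x ^ Suc l"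
    using x by (intro mult_right_mono) (auto simp: pow_dom_nonneg)
  finally show ?thesis using True by (simp add: pow_min_def)
qed

text \<open>Telescoping of q along x, 2x, 4x, ... down to the limit 0, phrased without a series: the
  difference g of q and c x^(-p) grows under doubling and tends to 0, hence is nonpositive.\<close>

lemma smallo_powr_of_dyadic:
  fixes q :: "real \<Rightarrow> real"
  assumes p: "p > 0" and q0: "(q \<longlongrightarrow> 0) at_top" and nn: "\<And>x. q x \<ge> 0"
    and dy: "\<And>\<epsilon>. \<epsilon> > 0 \<Longrightarrow> \<forall>\<^sub>F x in at_top. q x - q (2 * x) \<le> \<epsilon> * x powr (- p)"
  shows "q \<in> o[at_top](\<lambda>x. x powr (- p))"
proof (rule landau_o.smallI)
  fix c :: real assume c: "c > 0"
  define r where "r = (2::real) powr (- p)"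
  have r: "0 < r" "r < 1" using p by (auto simp: r_def powr_less_one)
  \<comment> \<open>Exactly what c x^(-p) loses when x is doubled, relative to x^(-p).\<close>
  have "c * (1 - r) > 0" using c r by simp
  from dy[OF this] obtain x0 where x0: "\<And>x. x \<ge> x0 \<Longrightarrow> q x - q (2 * x) \<le> c * (1 - r) * x powr (- p)"
    by (auto simp: eventually_at_top_linorder)
  define g where "g = (\<lambda>x. q x - c * x powr (- p))"
  have g_le: "g x \<le> g (2 * x)" if "x \<ge> max x0 1" for x
  proof -
    have "(2 * x) powr (- p) = r * x powr (- p)" using that by (simp add: r_def powr_mult)
    thus ?thesis using x0[of x] that by (simp add: g_def algebra_simps)
  qed
  have g_le_pow: "g x \<le> g (2 ^ n * x)" if x: "x \<ge> max x0 1" for x n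
  proof (induction n)
    case (Suc n)
    have "1 * x \<le> 2 ^ n * x" using x by (intro mult_right_mono) auto
    hence "2 ^ n * x \<ge> max x0 1" using x by linarith
    from order.trans[OF Suc g_le[OF this]] show ?case by (simp only: power_Suc mult.assoc)
  qed simp
  have "((\<lambda>x. c * x powr (- p)) \<longlongrightarrow> c * 0) at_top"
    using p by (intro tendsto_mult tendsto_const tendsto_neg_powr filterlim_ident) auto
  from tendsto_diff[OF q0 this] have g0: "(g \<longlongrightarrow> 0) at_top" by (simp add: g_def)
  have "q x \<le> c * x powr (- p)" if x: "x \<ge> max x0 1" for x
  proof -
    have "filterlim (\<lambda>n. 2 ^ n * x) at_top sequentially"
      using x by (intro filterlim_at_top_mult_tendsto_pos[OF tendsto_const]
          filterlim_at_infinity_imp_filterlim_at_top filterlim_realpow_sequentially_gt1) auto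
    from filterlim_compose[OF g0 this] have "(\<lambda>n. g (2 ^ n * x)) \<longlonglongrightarrow> 0" .
    from tendsto_lowerbound[OF this, of "g x"] g_le_pow[OF x] have "g x \<le> 0" by simp
    thus ?thesis by (simp add: g_def)
  qed
  thus "\<forall>\<^sub>F x in at_top. norm (q x) \<le> c * norm (x powr (- p))"
    using nn unfolding eventually_at_top_linorder by (intro exI[of _ "max x0 1"]) auto
qed

section \<open>The Abelian and Tauberian directions\<close>

context prob_space
begin

lemma nn_integral_pow_min_le:
  assumes [measurable]: "Y \<in> borel_measurable M" and Y: "\<And>\<omega>. 0 \<le> Y \<omega>" and v: "v > 0"
  shows "(\<integral>\<^sup>+ \<omega>. ennreal (pow_min l (v * Y \<omega>)) \<partial>M)
     \<le> (\<integral>\<^sup>+ s. ennreal (2 ^ (l + 2) * (s powr p * pow_dom p l s) * prob {\<omega> \<in> space M. Y \<omega> > s / v}) \<partial>lborel)"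
proof -
  interpret pair_sigma_finite M lborel ..
  let ?h = "\<lambda>s. 2 ^ (l + 2) * (s powr p * pow_dom p l s)"
  let ?f = "\<lambda>\<omega> s. ennreal (?h s) * indicator {(\<omega>, s). s < v * Y \<omega>} (\<omega>, s)"
  have "(\<integral>\<^sup>+ \<omega>. ennreal (pow_min l (v * Y \<omega>)) \<partial>M) \<le> (\<integral>\<^sup>+ \<omega>. (\<integral>\<^sup>+ s. ennreal (?h s) * indicator {..<v * Y \<omega>} s \<partial>lborel) \<partial>M)"
    using Y v by (intro nn_integral_mono pow_min_le_nn_integral) auto
  also have "\<dots> = (\<integral>\<^sup>+ \<omega>. (\<integral>\<^sup>+ s. ?f \<omega> s \<partial>lborel) \<partial>M)"
    by (intro nn_integral_cong) (auto simp: indicator_def)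
  also have "\<dots> = (\<integral>\<^sup>+ s. (\<integral>\<^sup>+ \<omega>. ?f \<omega> s \<partial>M) \<partial>lborel)"
    by (rule Fubini'[symmetric]) measurable
  also have "\<dots> = (\<integral>\<^sup>+ s. ennreal (?h s * prob {\<omega> \<in> space M. Y \<omega> > s / v}) \<partial>lborel)"
  proof (intro nn_integral_cong)
    fix s :: real
    have "(\<integral>\<^sup>+ \<omega>. ?f \<omega> s \<partial>M) = (\<integral>\<^sup>+ \<omega>. ennreal (?h s) * indicator {\<omega> \<in> space M. Y \<omega> > s / v} \<omega> \<partial>M)"
      using v by (intro nn_integral_cong) (auto simp: indicator_def field_simps)
    also have "\<dots> = ennreal (?h s) * emeasure M {\<omega> \<in> space M. Y \<omega> > s / v}"
      by (intro nn_integral_cmult_indicator) measurable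
    also have "\<dots> = ennreal (?h s * prob {\<omega> \<in> space M. Y \<omega> > s / v})"
      by (simp add: emeasure_eq_measure ennreal_mult' pow_dom_nonneg)
    finally show "(\<integral>\<^sup>+ \<omega>. ?f \<omega> s \<partial>M) = ennreal (?h s * prob {\<omega> \<in> space M. Y \<omega> > s / v})" .
  qed
  finally show ?thesis .
qed

lemma tail_measurable:
  assumes [measurable]: "Y \<in> borel_measurable M"
  shows "(\<lambda>x::real. prob {\<omega> \<in> space M. Y \<omega> > x}) \<in> borel_measurable borel"
proof -
  have "mono (\<lambda>x::real. - prob {\<omega> \<in> space M. Y \<omega> > x})"
    by (intro monoI le_imp_neg_le finite_measure_mono) auto
  from borel_measurable_uminus[OF borel_measurable_mono[OF this]] show ?thesis by simp
qed

text \<open>After the layer cake bound and the cancellation of v^p, the quantity is at most a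
  constant times the integral of \<open>pow_dom\<close> against x^p P(Y > x) at x = s/v. That factor
  is bounded, and as v tends to 0 it vanishes for each s > 0.\<close>

lemma pow_min_abelian:
  assumes [measurable]: "Y \<in> borel_measurable M" and Y: "\<And>\<omega>. 0 \<le> Y \<omega>"
    and p: "real l < p" "p < real l + 1"
    and tail: "(\<lambda>x. prob {\<omega> \<in> space M. Y \<omega> > x}) \<in> o[at_top](\<lambda>x. x powr (- p))"
  shows "\<And>v. v > 0 \<Longrightarrow> integrable M (\<lambda>\<omega>. pow_min l (v * Y \<omega>))"
    and "((\<lambda>v. v powr (- p) * expectation (\<lambda>\<omega>. pow_min l (v * Y \<omega>))) \<longlongrightarrow> 0) (at_right 0)"
proof -
  define q where "q = (\<lambda>x. prob {\<omega> \<in> space M. Y \<omega> > x})"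
  have q_meas [measurable]: "q \<in> borel_measurable borel"
    unfolding q_def by (rule tail_measurable) measurable
  have q01: "0 \<le> q x" "q x \<le> 1" for x by (auto simp: q_def)
  have p0: "p > 0" using p(1) by linarith
  have "((\<lambda>x. q x / x powr (- p)) \<longlongrightarrow> 0) at_top"
    using smalloD_tendsto[OF tail] by (simp add: q_def)
  hence lim: "((\<lambda>x. x powr p * q x) \<longlongrightarrow> 0) at_top"
    by (simp add: powr_minus divide_inverse mult.commute)
  \<comment> \<open>Beyond some x0 the limit gives a bound; below x0 the probability is at most 1
    and x^p at most |x0|^p.\<close>
  obtain K where K: "\<And>x. x > 0 \<Longrightarrow> x powr p * q x \<le> K" "K \<ge> 0"
  proof -
    from order_tendstoD(2)[OF lim zero_less_one] obtain x0 where x0: "\<And>x. x \<ge> x0 \<Longrightarrow> x powr p * q x < 1"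
      by (auto simp: eventually_at_top_linorder)
    have "x powr p * q x \<le> 1 + \<bar>x0\<bar> powr p" if "x > 0" for x
    proof (cases "x \<ge> x0")
      case True
      have "x powr p * q x \<le> 1" using x0[OF True] by simp
      moreover have "\<bar>x0\<bar> powr p \<ge> 0" by simp
      ultimately show ?thesis by linarith
    next
      case False
      have "x powr p * q x \<le> \<bar>x0\<bar> powr p * 1"
        using that False p0 q01[of x] by (intro mult_mono powr_mono2) auto
      thus ?thesis by simp
    qed
    thus ?thesis by (intro that[of "1 + \<bar>x0\<bar> powr p"]) (auto intro: add_nonneg_nonneg)
  qed
  let ?g = "\<lambda>v s. pow_dom p l s * ((s / v) powr p * q (s / v))"
  have g_le: "\<bar>?g v s\<bar> \<le> K * pow_dom p l s" if "v > 0" for v s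
  proof (cases "s > 0")
    case True
    thus ?thesis using K(1)[of "s / v"] that q01[of "s / v"] mult_left_mono[OF K(1)[of "s / v"] pow_dom_nonneg[of p l s]]
      by (simp add: abs_mult pow_dom_nonneg mult_ac)
  qed (simp add: pow_dom_def)
  have g_int: "integrable lborel (?g v)" if "v > 0" for v
    by (rule Bochner_Integration.integrable_bound[OF integrable_mult_right[OF integrable_pow_dom[OF p], of K]])
       (use g_le[OF that] K(2) in \<open>auto simp: pow_dom_nonneg abs_mult\<close>)
  have bound: "(\<integral>\<^sup>+ \<omega>. ennreal (pow_min l (v * Y \<omega>)) \<partial>M) \<le> ennreal (2 ^ (l + 2) * v powr p * (\<integral>s. ?g v s \<partial>lborel))" if v: "v > 0" for v
  proof -
    have "(\<integral>\<^sup>+ \<omega>. ennreal (pow_min l (v * Y \<omega>)) \<partial>M) \<le> (\<integral>\<^sup>+ s. ennreal (2 ^ (l + 2) * (s powr p * pow_dom p l s) * q (s / v)) \<partial>lborel)"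
      unfolding q_def by (rule nn_integral_pow_min_le) (use Y v in auto)
    also have "\<dots> = (\<integral>\<^sup>+ s. ennreal (2 ^ (l + 2) * v powr p * ?g v s) \<partial>lborel)"
    proof (intro nn_integral_cong)
      fix s :: real
      have "s powr p * pow_dom p l s = v powr p * (pow_dom p l s * (s / v) powr p)"
      proof (cases "s > 0")
        case True
        have "s powr p = v powr p * (s / v) powr p" using True v by (simp add: powr_divide)
        thus ?thesis by simp
      qed (simp add: pow_dom_def)
      thus "ennreal (2 ^ (l + 2) * (s powr p * pow_dom p l s) * q (s / v)) = ennreal (2 ^ (l + 2) * v powr p * ?g v s)"
        by (simp only: mult_ac)
    qed
    also have "\<dots> = ennreal (\<integral>s. 2 ^ (l + 2) * v powr p * ?g v s \<partial>lborel)"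
      using g_int[OF v] q01 by (intro nn_integral_eq_integral integrable_mult_right) (auto simp: pow_dom_nonneg)
    finally show ?thesis by simp
  qed
  have g_nn: "0 \<le> (\<integral>s. ?g v s \<partial>lborel)" for v
    using q01 by (intro Bochner_Integration.integral_nonneg) (auto simp: pow_dom_nonneg)
  show int: "integrable M (\<lambda>\<omega>. pow_min l (v * Y \<omega>))" if v: "v > 0" for v
    using le_less_trans[OF bound[OF v]] Y v
    by (intro integrableI_nonneg) (auto simp: pow_min_nonneg)
  have le: "v powr (- p) * expectation (\<lambda>\<omega>. pow_min l (v * Y \<omega>)) \<le> 2 ^ (l + 2) * (\<integral>s. ?g v s \<partial>lborel)" if v: "v > 0" for v
  proof -
    have "expectation (\<lambda>\<omega>. pow_min l (v * Y \<omega>)) \<le> 2 ^ (l + 2) * v powr p * (\<integral>s. ?g v s \<partial>lborel)"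
      using bound[OF v] g_nn[of v] by (intro integral_real_bounded) auto
    from mult_left_mono[OF this, of "v powr (- p)"] 
    have "v powr (- p) * expectation (\<lambda>\<omega>. pow_min l (v * Y \<omega>)) \<le> v powr (- p) * (2 ^ (l + 2) * v powr p * (\<integral>s. ?g v s \<partial>lborel))"
      by simp
    also have "v powr (- p) * (2 ^ (l + 2) * v powr p * (\<integral>s. ?g v s \<partial>lborel)) = (v powr (- p) * v powr p) * (2 ^ (l + 2) * (\<integral>s. ?g v s \<partial>lborel))"
      by (simp only: mult_ac)
    also have "v powr (- p) * v powr p = 1" using v by (simp add: powr_minus)
    finally show ?thesis by simp
  qed
  have "((\<lambda>v. \<integral>s. ?g v s \<partial>lborel) \<longlongrightarrow> 0) (at_right 0)"
  proof (rule tendsto_at_right_sequentially[of 0 1])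
    fix S :: "nat \<Rightarrow> real"
    assume S: "\<And>n. 0 < S n" "S \<longlonglongrightarrow> 0"
    have "(\<lambda>n. \<integral>s. ?g (S n) s \<partial>lborel) \<longlonglongrightarrow> (\<integral>s. 0 \<partial>(lborel::real measure))"
    proof (rule integral_dominated_convergence[where w = "\<lambda>s. K * pow_dom p l s"])
      show "integrable lborel (\<lambda>s. K * pow_dom p l s)"
        by (intro integrable_mult_right integrable_pow_dom p)
      show "AE s in lborel. norm (?g (S n) s) \<le> K * pow_dom p l s" for n
        using g_le[OF S(1)] by (intro always_eventually allI) auto
      show "AE s in lborel. (\<lambda>n. ?g (S n) s) \<longlonglongrightarrow> 0"
      proof (intro always_eventually allI)
        fix s :: real
        show "(\<lambda>n. ?g (S n) s) \<longlonglongrightarrow> 0"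
        proof (cases "s > 0")
          case True
          have "filterlim S (at_right 0) sequentially"
            using S(2) less_imp_neq[OF S(1)] S(1) by (auto simp: filterlim_at intro!: always_eventually)
          hence "filterlim (\<lambda>n. inverse (S n)) at_top sequentially"
            by (rule filterlim_compose[OF filterlim_inverse_at_top_right])
          hence "filterlim (\<lambda>n. s * inverse (S n)) at_top sequentially"
            by (rule filterlim_tendsto_pos_mult_at_top[OF tendsto_const True])
          hence "filterlim (\<lambda>n. s / S n) at_top sequentially" by (simp add: divide_inverse)
          from tendsto_mult[OF tendsto_const[of "pow_dom p l s"] filterlim_compose[OF lim this]]
          show ?thesis by simp
        qed (simp add: pow_dom_def)
      qed
    qed auto
    thus "(\<lambda>n. \<integral>s. ?g (S n) s \<partial>lborel) \<longlonglongrightarrow> 0" by simp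
  qed simp
  from tendsto_mult[OF tendsto_const[of "2 ^ (l + 2)"] this]
  have "((\<lambda>v. 2 ^ (l + 2) * (\<integral>s. ?g v s \<partial>lborel)) \<longlongrightarrow> 0) (at_right 0)" by simp
  thus "((\<lambda>v. v powr (- p) * expectation (\<lambda>\<omega>. pow_min l (v * Y \<omega>))) \<longlongrightarrow> 0) (at_right 0)"
  proof (rule tendsto_sandwich[OF _ _ tendsto_const, rotated 2])
    show "\<forall>\<^sub>F v in at_right 0. 0 \<le> v powr (- p) * expectation (\<lambda>\<omega>. pow_min l (v * Y \<omega>))"
      unfolding eventually_at_right_field
      by (intro exI[of _ 1]) (auto intro!: mult_nonneg_nonneg Bochner_Integration.integral_nonneg pow_min_nonneg Y)
    show "\<forall>\<^sub>F v in at_right 0. v powr (- p) * expectation (\<lambda>\<omega>. pow_min l (v * Y \<omega>)) \<le> 2 ^ (l + 2) * (\<integral>s. ?g v s \<partial>lborel)"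
      unfolding eventually_at_right_field by (intro exI[of _ 1]) (use le in auto)
  qed
qed

lemma tail_tendsto_0:
  fixes Y :: "'a \<Rightarrow> real"
  assumes [measurable]: "Y \<in> borel_measurable M"
  shows "((\<lambda>x. prob {\<omega> \<in> space M. Y \<omega> > x}) \<longlongrightarrow> 0) at_top"
proof -
  have "((\<lambda>x. \<integral>\<omega>. indicator {\<omega> \<in> space M. Y \<omega> > x} \<omega> \<partial>M) \<longlongrightarrow> (\<integral>\<omega>. (0::real) \<partial>M)) at_top"
  proof (rule integral_dominated_convergence_at_top[where w = "\<lambda>_. 1"])
    show "AE \<omega> in M. ((\<lambda>x. indicator {\<omega> \<in> space M. Y \<omega> > x} \<omega> :: real) \<longlongrightarrow> 0) at_top"
    proof (intro always_eventually allI)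
      fix \<omega>
      show "((\<lambda>x. indicator {\<omega> \<in> space M. Y \<omega> > x} \<omega> :: real) \<longlongrightarrow> 0) at_top"
        by (intro tendsto_eventually, rule eventually_mono[OF eventually_ge_at_top[of "Y \<omega>"]]) (auto simp: indicator_def)
    qed
  qed (auto simp: indicator_def)
  thus ?thesis by simp
qed

text \<open>With the sign (-1)^l, T 1 (-y) is nonnegative and dominates \<delta> times the indicator
  of [c, 2c], so its expectation at scale v bounds a dyadic block of the tail.\<close>

lemma trunc_int_tauberian:
  assumes [measurable]: "Y \<in> borel_measurable M" and Y: "\<And>\<omega>. 0 \<le> Y \<omega>"
    and p: "real l < p" "p < real l + 1"
    and int: "\<And>v. v > 0 \<Longrightarrow> integrable M (\<lambda>\<omega>. trunc_int p l v (- Y \<omega>))"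
    and lim: "((\<lambda>v. expectation (\<lambda>\<omega>. trunc_int p l v (- Y \<omega>))) \<longlongrightarrow> 0) (at_right 0)"
  shows "(\<lambda>x. prob {\<omega> \<in> space M. Y \<omega> > x}) \<in> o[at_top](\<lambda>x. x powr (- p))"
proof (rule smallo_powr_of_dyadic)
  show "p > 0" using p(1) by linarith
  show "((\<lambda>x. prob {\<omega> \<in> space M. Y \<omega> > x}) \<longlongrightarrow> 0) at_top"
    by (rule tail_tendsto_0) measurable
  fix \<epsilon> :: real assume \<epsilon>: "\<epsilon> > 0"
  from trunc_int_sign[OF p] obtain c \<delta> where nn: "\<And>x. x \<ge> 0 \<Longrightarrow> (-1) ^ l * trunc_int p l 1 (- x) \<ge> 0"
    and c: "c > 0" "\<delta> > 0" "\<And>x. x \<in> {c..2*c} \<Longrightarrow> (-1) ^ l * trunc_int p l 1 (- x) \<ge> \<delta>" by blast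
  have key: "\<delta> * prob {\<omega> \<in> space M. x < Y \<omega> \<and> Y \<omega> \<le> 2 * x} \<le> (c / x) powr p * \<bar>expectation (\<lambda>\<omega>. trunc_int p l (c / x) (- Y \<omega>))\<bar>"
    if x: "x > 0" for x
  proof -
    \<comment> \<open>This scale maps the block x < Y <= 2x into [c, 2c].\<close>
    define v where "v = c / x"
    have v: "v > 0" using x c by (simp add: v_def)
    have sc: "trunc_int p l 1 (- (v * Y \<omega>)) = v powr p * trunc_int p l v (- Y \<omega>)" for \<omega>
      using trunc_int_scale[of v 1 p l "- Y \<omega>"] v by simp
    have i: "integrable M (\<lambda>\<omega>. (-1) ^ l * trunc_int p l 1 (- (v * Y \<omega>)))"
      unfolding sc by (intro integrable_mult_right int v)
    have "\<delta> * prob {\<omega> \<in> space M. x < Y \<omega> \<and> Y \<omega> \<le> 2 * x} = expectation (\<lambda>\<omega>. \<delta> * indicator {\<omega> \<in> space M. x < Y \<omega> \<and> Y \<omega> \<le> 2 * x} \<omega>)"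
      by simp
    also have "\<dots> \<le> expectation (\<lambda>\<omega>. (-1) ^ l * trunc_int p l 1 (- (v * Y \<omega>)))"
    proof (rule integral_mono[OF _ i])
      show "integrable M (\<lambda>\<omega>. \<delta> * indicator {\<omega> \<in> space M. x < Y \<omega> \<and> Y \<omega> \<le> 2 * x} \<omega>)"
        by (intro integrable_mult_right integrable_real_indicator) (auto simp: emeasure_eq_measure)
      fix \<omega> assume "\<omega> \<in> space M"
      show "\<delta> * indicator {\<omega> \<in> space M. x < Y \<omega> \<and> Y \<omega> \<le> 2 * x} \<omega> \<le> (-1) ^ l * trunc_int p l 1 (- (v * Y \<omega>))"
      proof (cases "x < Y \<omega> \<and> Y \<omega> \<le> 2 * x")
        case True
        hence "v * Y \<omega> \<in> {c..2*c}" using x c by (simp add: v_def field_simps)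
        from c(3)[OF this] show ?thesis using True \<open>\<omega> \<in> space M\<close> by simp
      next
        case False
        thus ?thesis using nn[of "v * Y \<omega>"] v Y[of \<omega>] by (auto simp: indicator_def)
      qed
    qed
    also have "\<dots> \<le> \<bar>expectation (\<lambda>\<omega>. (-1) ^ l * trunc_int p l 1 (- (v * Y \<omega>)))\<bar>" by simp
    also have "\<dots> = v powr p * \<bar>expectation (\<lambda>\<omega>. trunc_int p l v (- Y \<omega>))\<bar>"
      unfolding sc integral_mult_right_zero by (simp add: abs_mult power_abs)
    finally show ?thesis by (simp add: v_def)
  qed
  \<comment> \<open>Chosen so that (c/x)^p e = \<delta> \<epsilon> x^(-p).\<close>
  define e where "e = \<epsilon> * \<delta> / c powr p"
  have e: "e > 0" using \<epsilon> c by (simp add: e_def)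
  have fl: "filterlim (\<lambda>x. c / x) (at_right 0) at_top"
  proof -
    have "((\<lambda>x. c / x) \<longlongrightarrow> 0) at_top"
      by (rule tendsto_divide_0[OF tendsto_const]) (rule filterlim_at_top_imp_at_infinity[OF filterlim_ident])
    moreover have "\<forall>\<^sub>F x in at_top. c / x > 0"
      using eventually_gt_at_top[of 0] by eventually_elim (use c in simp)
    ultimately show ?thesis by (auto simp: filterlim_at elim: eventually_mono)
  qed
  have "\<forall>\<^sub>F v in at_right 0. \<bar>expectation (\<lambda>\<omega>. trunc_int p l v (- Y \<omega>))\<bar> < e"
    using order_tendstoD(2)[OF tendsto_rabs_zero[OF lim] e] .
  from eventually_compose_filterlim[OF this fl]
  have "\<forall>\<^sub>F x in at_top. \<bar>expectation (\<lambda>\<omega>. trunc_int p l (c / x) (- Y \<omega>))\<bar> < e" .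
  with eventually_gt_at_top[of 0]
  show "\<forall>\<^sub>F x in at_top. prob {\<omega> \<in> space M. Y \<omega> > x} - prob {\<omega> \<in> space M. Y \<omega> > 2 * x} \<le> \<epsilon> * x powr (- p)"
  proof eventually_elim
    case (elim x)
    have "prob {\<omega> \<in> space M. Y \<omega> > x} - prob {\<omega> \<in> space M. Y \<omega> > 2 * x} = prob ({\<omega> \<in> space M. Y \<omega> > x} - {\<omega> \<in> space M. Y \<omega> > 2 * x})"
      using elim by (intro finite_measure_Diff[symmetric]) auto
    also have "{\<omega> \<in> space M. Y \<omega> > x} - {\<omega> \<in> space M. Y \<omega> > 2 * x} = {\<omega> \<in> space M. x < Y \<omega> \<and> Y \<omega> \<le> 2 * x}"
      by auto
    finally have "\<delta> * (prob {\<omega> \<in> space M. Y \<omega> > x} - prob {\<omega> \<in> space M. Y \<omega> > 2 * x}) \<le> (c / x) powr p * \<bar>expectation (\<lambda>\<omega>. trunc_int p l (c / x) (- Y \<omega>))\<bar>"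
      using key[of x] elim by simp
    also have "\<dots> \<le> (c / x) powr p * e"
      using elim by (intro mult_left_mono) auto
    also have "\<dots> = \<delta> * (\<epsilon> * x powr (- p))"
      using c elim by (simp add: e_def powr_divide powr_minus field_simps)
    finally show ?case using c by simp
  qed
qed simp

text \<open>Away from t = 0 the bound of order l is integrable in t, so the l-th moment alone
  justifies Fubini; this is where v > 0 matters. Fubini yields integrability over [v, infinity)
  along with the value.\<close>

lemma expectation_trunc_int:
  assumes [measurable]: "X \<in> borel_measurable M"
    and p: "real l < p"
    and X: "integrable M (\<lambda>\<omega>. \<bar>X \<omega>\<bar> ^ l)" and v: "v > 0"
  defines "R \<equiv> \<lambda>t. Re (expectation (\<lambda>\<omega>. exp_rem l (\<i> * complex_of_real (t * X \<omega>))) / it_pow p t)"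
  shows "integrable M (\<lambda>\<omega>. trunc_int p l v (X \<omega>))"
    and "set_integrable lborel {v..} R"
    and "(LINT t:{v..}|lborel. R t) = expectation (\<lambda>\<omega>. trunc_int p l v (X \<omega>))"
proof -
  interpret pair_sigma_finite M lborel ..
  let ?f = "\<lambda>\<omega> t. indicator {v..} t * kern p l t (X \<omega>)"
  have exp_rem_meas [measurable]: "exp_rem l \<in> borel_measurable borel"
    unfolding exp_rem_def[abs_def] by measurable
  have R: "R t = expectation (\<lambda>\<omega>. kern p l t (X \<omega>))" for t
  proof -
    have "integrable M (\<lambda>\<omega>. exp_rem l (\<i> * complex_of_real (t * X \<omega>)))"
    proof (rule Bochner_Integration.integrable_bound[OF integrable_mult_right[OF X, of "2 * \<bar>t\<bar> ^ l"]])
      show "AE \<omega> in M. norm (exp_rem l (\<i> * complex_of_real (t * X \<omega>))) \<le> norm (2 * \<bar>t\<bar> ^ l * \<bar>X \<omega>\<bar> ^ l)"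
        using norm_exp_rem_le1[of l "t * X _"] by (intro always_eventually allI) (simp add: abs_mult power_mult_distrib mult.assoc)
    qed measurable
    hence "integrable M (\<lambda>\<omega>. exp_rem l (\<i> * complex_of_real (t * X \<omega>)) / it_pow p t)"
      by (rule integrable_divide)
    from integral_Re[OF this] show ?thesis
      unfolding R_def kern_def by simp
  qed
  define L where "L = (\<integral>t. indicator {v..} t * t powr (real l - p - 1) \<partial>lborel)"
  have "((\<lambda>t. t powr (real l - p - 1)) has_integral (- (v powr (real l - p - 1 + 1)) / (real l - p - 1 + 1))) {v..}"
    using p v by (intro has_integral_powr_to_inf) auto
  hence "(\<integral>\<^sup>+ t. ennreal (indicator {v..} t * t powr (real l - p - 1)) \<partial>lborel) = ennreal (- (v powr (real l - p - 1 + 1)) / (real l - p - 1 + 1))"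
    by (intro nn_integral_has_integral_lebesgue) auto
  hence L: "integrable lborel (\<lambda>t. indicator {v..} t * t powr (real l - p - 1))"
    by (intro integrableI_nonneg) auto
  have bound: "\<bar>?f \<omega> t\<bar> \<le> 2 * \<bar>X \<omega>\<bar> ^ l * (indicator {v..} t * t powr (real l - p - 1))" for \<omega> t
    using abs_kern_le_large[of t p l "X \<omega>"] v by (auto simp: indicator_def)
  have ik: "integrable lborel (?f \<omega>)" for \<omega>
    by (rule Bochner_Integration.integrable_bound[OF integrable_mult_right[OF L, of "2 * \<bar>X \<omega>\<bar> ^ l"]])
       (use bound[of _ "\<omega>"] in \<open>auto simp: abs_mult\<close>)
  have int: "integrable (M \<Otimes>\<^sub>M lborel) (case_prod ?f)"
  proof (rule Fubini_integrable)
    show "integrable M (\<lambda>\<omega>. \<integral>t. norm (case_prod ?f (\<omega>, t)) \<partial>lborel)"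
    proof (rule Bochner_Integration.integrable_bound)
      show "integrable M (\<lambda>\<omega>. 2 * \<bar>X \<omega>\<bar> ^ l * L)"
        by (intro integrable_mult_left integrable_mult_right X)
      show "AE \<omega> in M. norm (\<integral>t. norm (case_prod ?f (\<omega>, t)) \<partial>lborel) \<le> norm (2 * \<bar>X \<omega>\<bar> ^ l * L)"
      proof (intro always_eventually allI)
        fix \<omega>
        have "(\<integral>t. norm (?f \<omega> t) \<partial>lborel) \<le> (\<integral>t. 2 * \<bar>X \<omega>\<bar> ^ l * (indicator {v..} t * t powr (real l - p - 1)) \<partial>lborel)"
          using bound[of _ "\<omega>"] by (intro integral_mono integrable_mult_right L integrable_norm ik) auto
        also have "\<dots> = 2 * \<bar>X \<omega>\<bar> ^ l * L" unfolding L_def by (rule integral_mult_right_zero)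
        finally have "(\<integral>t. norm (?f \<omega> t) \<partial>lborel) \<le> 2 * \<bar>X \<omega>\<bar> ^ l * L" .
        moreover have "(\<integral>t. norm (?f \<omega> t) \<partial>lborel) \<ge> 0" by simp
        ultimately show "norm (\<integral>t. norm (case_prod ?f (\<omega>, t)) \<partial>lborel) \<le> norm (2 * \<bar>X \<omega>\<bar> ^ l * L)"
          by simp
      qed
    qed measurable
  qed (use ik in auto)
  have eq1: "(\<integral>t. ?f \<omega> t \<partial>lborel) = trunc_int p l v (X \<omega>)" for \<omega>
    by (simp add: trunc_int_def)
  have eq2: "(\<integral>\<omega>. ?f \<omega> t \<partial>M) = indicator {v..} t *\<^sub>R R t" for t
    by (simp add: R)
  show "integrable M (\<lambda>\<omega>. trunc_int p l v (X \<omega>))"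
    using integrable_fst'[OF int] by (simp only: prod.case eq1)
  show "set_integrable lborel {v..} R"
    using integrable_snd[OF int] unfolding set_integrable_def by (simp only: eq2)
  show "(LINT t:{v..}|lborel. R t) = expectation (\<lambda>\<omega>. trunc_int p l v (X \<omega>))"
    using Fubini_integral[OF int] unfolding set_lebesgue_integral_def by (simp only: eq1 eq2)
qed

end

theorem theorem2p5:
  fixes M :: "'a measure" and X :: "'a \<Rightarrow> real" and p :: real
  assumes "prob_space M"
    and "X \<in> borel_measurable M"
    and "p > 0" and "p \<notin> \<nat>"
    and "integrable M (\<lambda>\<omega>. (max 0 (X \<omega>)) powr p)"
  shows "(integrable M (\<lambda>\<omega>. \<bar>X \<omega>\<bar> ^ nat \<lceil>p - 1\<rceil>) \<and>
          (\<forall>v>0. set_integrable lborel {v..}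
             (\<lambda>t. Re ((\<integral>\<omega>. exp_rem (nat \<lceil>p - 1\<rceil>) (\<i> * complex_of_real (t * X \<omega>)) \<partial>M)
                     / it_pow p t))) \<and>
          ((\<lambda>v. Gamma (p + 1) / pi *
              (LINT t:{v..}|lborel.
                 Re ((\<integral>\<omega>. exp_rem (nat \<lceil>p - 1\<rceil>) (\<i> * complex_of_real (t * X \<omega>)) \<partial>M)
                     / it_pow p t)))
            \<longlongrightarrow> (\<integral>\<omega>. (max 0 (X \<omega>)) powr p \<partial>M)) (at_right 0))
     \<longleftrightarrow>
         (\<lambda>x. measure M {\<omega> \<in> space M. max 0 (- X \<omega>) > x}) \<in> o[at_top](\<lambda>x. x powr (- p))"
proof -
  interpret prob_space M by fact
  note [measurable] = assms(2)
  define l where "l = nat \<lceil>p - 1\<rceil>"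
  define Y where "Y = (\<lambda>\<omega>. max 0 (- X \<omega>))"
  define Z where "Z = (\<lambda>\<omega>. max 0 (X \<omega>))"
  have [measurable]: "Y \<in> borel_measurable M" "Z \<in> borel_measurable M" by (auto simp: Y_def Z_def)
  have Y: "Y \<omega> \<ge> 0" and Z: "Z \<omega> \<ge> 0" for \<omega> by (auto simp: Y_def Z_def)
  have G: "Gamma (p + 1) > 0" using assms(3) by (intro Gamma_real_pos) auto
  have p: "real l < p" "p < real l + 1"
  proof -
    have "\<lceil>p - 1\<rceil> \<ge> 0" using assms(3) by linarith
    hence l: "real l = of_int \<lceil>p - 1\<rceil>" by (simp add: l_def)
    show "real l < p" unfolding l by linarith
    \<comment> \<open>The ceiling alone gives p <= l + 1; equality is excluded because p is not a
      natural number.\<close>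
    have "p \<noteq> real (Suc l)" using assms(4) by (metis of_nat_in_Nats)
    moreover have "p \<le> real l + 1" unfolding l by linarith
    ultimately show "p < real l + 1" by simp
  qed
  have Zp: "integrable M (\<lambda>\<omega>. Z \<omega> powr p)" using assms(5) by (simp add: Z_def)
  define C where "C = 4 * integral\<^sup>L lborel (pow_dom p l)"
  have T_le: "\<bar>trunc_int p l v x\<bar> \<le> C * \<bar>x\<bar> powr p" if "v \<ge> 0" for v x
    unfolding C_def by (rule abs_trunc_int_le[OF p that])
  have Z_int: "integrable M (\<lambda>\<omega>. trunc_int p l v (Z \<omega>))" if "v \<ge> 0" for v
    using T_le[OF that, of "Z _"] Z
    by (intro Bochner_Integration.integrable_bound[OF integrable_mult_right[OF Zp, of C]])
       (auto intro!: always_eventually intro: order.trans[OF _ abs_ge_self])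
  have Z_lim: "((\<lambda>v. expectation (\<lambda>\<omega>. trunc_int p l v (Z \<omega>))) \<longlongrightarrow> pi / Gamma (p + 1) * expectation (\<lambda>\<omega>. Z \<omega> powr p)) (at_right 0)"
  proof (rule tendsto_at_right_sequentially[of 0 1])
    fix S :: "nat \<Rightarrow> real"
    assume S: "\<And>n. 0 < S n" "S \<longlonglongrightarrow> 0"
    have S': "filterlim S (at_right 0) sequentially"
      using S(2) less_imp_neq[OF S(1)] S(1) by (auto simp: filterlim_at intro!: always_eventually)
    have "(\<lambda>n. expectation (\<lambda>\<omega>. trunc_int p l (S n) (Z \<omega>))) \<longlonglongrightarrow> expectation (\<lambda>\<omega>. trunc_int p l 0 (Z \<omega>))"
    proof (rule integral_dominated_convergence[where w = "\<lambda>\<omega>. C * Z \<omega> powr p"])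
      show "integrable M (\<lambda>\<omega>. C * Z \<omega> powr p)" by (intro integrable_mult_right Zp)
      show "AE \<omega> in M. norm (trunc_int p l (S n) (Z \<omega>)) \<le> C * Z \<omega> powr p" for n
        using T_le[OF less_imp_le[OF S(1)], of _ "Z _"] Z by (intro always_eventually) simp
      show "AE \<omega> in M. (\<lambda>n. trunc_int p l (S n) (Z \<omega>)) \<longlonglongrightarrow> trunc_int p l 0 (Z \<omega>)"
        by (intro always_eventually allI filterlim_compose[OF trunc_int_tendsto[OF p] S'])
    qed auto
    also have "expectation (\<lambda>\<omega>. trunc_int p l 0 (Z \<omega>)) = pi / Gamma (p + 1) * expectation (\<lambda>\<omega>. Z \<omega> powr p)"
      using Z by (simp add: trunc_int_zero_eq[OF p] max_def)
    finally show "(\<lambda>n. expectation (\<lambda>\<omega>. trunc_int p l (S n) (Z \<omega>))) \<longlonglongrightarrow> pi / Gamma (p + 1) * expectation (\<lambda>\<omega>. Z \<omega> powr p)" .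
  qed simp
  have T0: "trunc_int p l v 0 = 0" for v by (simp add: trunc_int_def)
  have split: "trunc_int p l v (X \<omega>) = trunc_int p l v (Z \<omega>) + trunc_int p l v (- Y \<omega>)" for v \<omega>
    by (cases "X \<omega> \<ge> 0") (auto simp: Y_def Z_def T0)
  define R where "R = (\<lambda>t. Re (expectation (\<lambda>\<omega>. exp_rem l (\<i> * complex_of_real (t * X \<omega>))) / it_pow p t))"
  \<comment> \<open>Integrability for Y is obtained by subtracting the part of Z from that of X,
    since E Y^p may be infinite and then offers no domination.\<close>
  have Y_int: "integrable M (\<lambda>\<omega>. trunc_int p l v (- Y \<omega>))"
    and R_int: "set_integrable lborel {v..} R"
    and R_eq: "(LINT t:{v..}|lborel. R t) = expectation (\<lambda>\<omega>. trunc_int p l v (Z \<omega>)) + expectation (\<lambda>\<omega>. trunc_int p l v (- Y \<omega>))"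
    if "integrable M (\<lambda>\<omega>. \<bar>X \<omega>\<bar> ^ l)" "v > 0" for v
  proof -
    note E = expectation_trunc_int[OF assms(2) p(1) that]
    show R_int: "set_integrable lborel {v..} R" unfolding R_def by (rule E(2))
    have "integrable M (\<lambda>\<omega>. trunc_int p l v (X \<omega>) - trunc_int p l v (Z \<omega>))"
      using that by (intro Bochner_Integration.integrable_diff E(1) Z_int) auto
    thus Y: "integrable M (\<lambda>\<omega>. trunc_int p l v (- Y \<omega>))" unfolding split by simp
    show "(LINT t:{v..}|lborel. R t) = expectation (\<lambda>\<omega>. trunc_int p l v (Z \<omega>)) + expectation (\<lambda>\<omega>. trunc_int p l v (- Y \<omega>))"
      unfolding R_def E(3) split using that by (intro Bochner_Integration.integral_add Z_int Y) auto
  qed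
  have lim_iff: "((\<lambda>v. Gamma (p + 1) / pi * (LINT t:{v..}|lborel. R t)) \<longlongrightarrow> expectation (\<lambda>\<omega>. Z \<omega> powr p)) (at_right 0)
      \<longleftrightarrow> ((\<lambda>v. expectation (\<lambda>\<omega>. trunc_int p l v (- Y \<omega>))) \<longlongrightarrow> 0) (at_right 0)"
    if X: "integrable M (\<lambda>\<omega>. \<bar>X \<omega>\<bar> ^ l)"
  proof
    assume "((\<lambda>v. Gamma (p + 1) / pi * (LINT t:{v..}|lborel. R t)) \<longlongrightarrow> expectation (\<lambda>\<omega>. Z \<omega> powr p)) (at_right 0)"
    from tendsto_diff[OF tendsto_mult[OF tendsto_const[of "pi / Gamma (p + 1)"] this] Z_lim]
    have "((\<lambda>v. pi / Gamma (p + 1) * (Gamma (p + 1) / pi * (LINT t:{v..}|lborel. R t)) - expectation (\<lambda>\<omega>. trunc_int p l v (Z \<omega>))) \<longlongrightarrow> 0) (at_right 0)"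
      by simp
    moreover have "\<forall>\<^sub>F v in at_right 0. pi / Gamma (p + 1) * (Gamma (p + 1) / pi * (LINT t:{v..}|lborel. R t)) - expectation (\<lambda>\<omega>. trunc_int p l v (Z \<omega>))
        = expectation (\<lambda>\<omega>. trunc_int p l v (- Y \<omega>))"
      using eventually_at_right_less[of "0::real"] by eventually_elim (use G in \<open>simp add: R_eq[OF X]\<close>)
    ultimately show "((\<lambda>v. expectation (\<lambda>\<omega>. trunc_int p l v (- Y \<omega>))) \<longlongrightarrow> 0) (at_right 0)"
      by (rule Lim_transform_eventually)
  next
    assume "((\<lambda>v. expectation (\<lambda>\<omega>. trunc_int p l v (- Y \<omega>))) \<longlongrightarrow> 0) (at_right 0)"
    from tendsto_mult[OF tendsto_const[of "Gamma (p + 1) / pi"] tendsto_add[OF Z_lim this]]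
    have "((\<lambda>v. Gamma (p + 1) / pi * (expectation (\<lambda>\<omega>. trunc_int p l v (Z \<omega>)) + expectation (\<lambda>\<omega>. trunc_int p l v (- Y \<omega>))))
       \<longlongrightarrow> expectation (\<lambda>\<omega>. Z \<omega> powr p)) (at_right 0)"
      using G by simp
    moreover have "\<forall>\<^sub>F v in at_right 0. Gamma (p + 1) / pi * (expectation (\<lambda>\<omega>. trunc_int p l v (Z \<omega>)) + expectation (\<lambda>\<omega>. trunc_int p l v (- Y \<omega>)))
        = Gamma (p + 1) / pi * (LINT t:{v..}|lborel. R t)"
      using eventually_at_right_less[of "0::real"] by eventually_elim (simp add: R_eq[OF X])
    ultimately show "((\<lambda>v. Gamma (p + 1) / pi * (LINT t:{v..}|lborel. R t)) \<longlongrightarrow> expectation (\<lambda>\<omega>. Z \<omega> powr p)) (at_right 0)"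
      by (rule Lim_transform_eventually)
  qed
  have "(integrable M (\<lambda>\<omega>. \<bar>X \<omega>\<bar> ^ l) \<and> (\<forall>v>0. set_integrable lborel {v..} R) \<and>
      ((\<lambda>v. Gamma (p + 1) / pi * (LINT t:{v..}|lborel. R t)) \<longlongrightarrow> expectation (\<lambda>\<omega>. Z \<omega> powr p)) (at_right 0))
    \<longleftrightarrow> (\<lambda>x. prob {\<omega> \<in> space M. Y \<omega> > x}) \<in> o[at_top](\<lambda>x. x powr (- p))" (is "?I \<longleftrightarrow> ?II")
  proof
    assume ?I
    thus ?II using lim_iff Y_int by (intro trunc_int_tauberian[OF _ Y p]) auto
  next
    assume ?II
    note A = pow_min_abelian[OF _ Y p this]
    \<comment> \<open>The l-th moment in (I) has to be derived from (II): the right half is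
      controlled by E X_+^p, the left half by the Abelian lemma at v = 1.\<close>
    have X: "integrable M (\<lambda>\<omega>. \<bar>X \<omega>\<bar> ^ l)"
    proof (rule Bochner_Integration.integrable_bound)
      show "integrable M (\<lambda>\<omega>. 1 + Z \<omega> powr p + (1 + pow_min l (1 * Y \<omega>)))"
        by (intro Bochner_Integration.integrable_add Zp A(1)) auto
      show "AE \<omega> in M. norm (\<bar>X \<omega>\<bar> ^ l) \<le> norm (1 + Z \<omega> powr p + (1 + pow_min l (1 * Y \<omega>)))"
      proof (intro always_eventually allI)
        fix \<omega>
        have "\<bar>X \<omega>\<bar> ^ l \<le> 1 + Z \<omega> powr p + (1 + pow_min l (1 * Y \<omega>))"
        proof (cases "X \<omega> \<ge> 0")
          case True
          have "X \<omega> ^ l \<le> 1 + X \<omega> powr p"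
          proof (cases "X \<omega> \<le> 1")
            case 1: True
            have "X \<omega> ^ l \<le> 1" using 1 True by (intro power_le_one)
            thus ?thesis using powr_ge_zero[of "X \<omega>" p] by linarith
          next
            case False
            hence "X \<omega> powr real l \<le> X \<omega> powr p" using p by (intro powr_mono) auto
            thus ?thesis using False by (simp add: powr_realpow)
          qed
          thus ?thesis using True pow_min_nonneg[OF Y, of l \<omega>] by (simp add: Z_def)
        next
          case False
          thus ?thesis using power_le_pow_min[OF Y, of \<omega> l] by (simp add: Y_def Z_def)
        qed
        thus "norm (\<bar>X \<omega>\<bar> ^ l) \<le> norm (1 + Z \<omega> powr p + (1 + pow_min l (1 * Y \<omega>)))"
          by simp
      qed
    qed measurable
    define K where "K = 2 * integral\<^sup>L lborel (pow_dom p l)"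
    have "((\<lambda>v. expectation (\<lambda>\<omega>. trunc_int p l v (- Y \<omega>))) \<longlongrightarrow> 0) (at_right 0)"
    proof (rule Lim_null_comparison)
      show "((\<lambda>v. K * (v powr (- p) * expectation (\<lambda>\<omega>. pow_min l (v * Y \<omega>)))) \<longlongrightarrow> 0) (at_right 0)"
        using tendsto_mult[OF tendsto_const[of K] A(2)] by simp
      show "\<forall>\<^sub>F v in at_right 0. norm (expectation (\<lambda>\<omega>. trunc_int p l v (- Y \<omega>))) \<le> K * (v powr (- p) * expectation (\<lambda>\<omega>. pow_min l (v * Y \<omega>)))"
        using eventually_at_right_less[of "0::real"]
      proof eventually_elim
        case (elim v)
        have "norm (expectation (\<lambda>\<omega>. trunc_int p l v (- Y \<omega>))) \<le> expectation (\<lambda>\<omega>. K * v powr (- p) * pow_min l (v * Y \<omega>))"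
        proof (rule order.trans[OF integral_norm_bound integral_mono])
          fix \<omega>
          have "trunc_int p l v (- Y \<omega>) = v powr (- p) * trunc_int p l 1 (- (v * Y \<omega>))"
            using trunc_int_scale[of v 1 p l "- Y \<omega>"] elim by (simp add: powr_minus)
          thus "norm (trunc_int p l v (- Y \<omega>)) \<le> K * v powr (- p) * pow_min l (v * Y \<omega>)"
            using mult_left_mono[OF abs_trunc_int_neg_le[OF p, of "v * Y \<omega>"], of "v powr (- p)"] elim Y[of \<omega>]
            by (simp add: abs_mult K_def mult_ac)
        qed (use elim X in \<open>auto intro!: Y_int A(1) integrable_norm\<close>)
        thus ?case by (simp add: mult_ac)
      qed
    qed
    thus ?I using X R_int lim_iff by auto
  qed
  thus ?thesis unfolding R_def Y_def Z_def l_def .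
qed

end
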